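(* Consider the RR-Cluster algorithm with $M$ clients, client sampling ratio $q$ and $T$ communication rounds. Suppose that the randomized mechanism $\mathcal{M}$ which, in a single communication round, takes the subset of selected clients $M^t$ as input and outputs the $k$ new cluster models satisfies $(\alpha,\varepsilon_1(\alpha)+\varepsilon_2(\alpha))$-RDP (where $\varepsilon_1(\cdot),\varepsilon_2(\cdot)$ are functions of the order $\alpha$, with orders up to and including $\infty$). Then for every integer $\alpha\ge 2$ the RR-Cluster algorithm (the composition of $T$ rounds, each with client subsampling) satisfies $(\alpha,\varepsilon(\alpha))$-RDP with $$\varepsilon(\alpha)\le \frac{T}{\alpha-1}\log\Biggl(1+q^2\binom{\alpha}{2}\min\Bigl\{4\bigl(e^{\varepsilon_1(2)+\varepsilon_2(2)}-1\bigr),\ e^{\varepsilon_1(2)+\varepsilon_2(2)}\min\bigl\{2,\bigl(e^{\varepsilon_1(\infty)+\varepsilon_2(\infty)}-1\bigr)^2\bigr\}\Bigr\}$$ $$\qquad\qquad+\sum_{j=3}^{\alpha}q^j\binom{\alpha}{j}e^{(j-1)(\varepsilon_1(j)+\varepsilon_2(j))}\min\bigl\{2,\bigl(e^{\varepsilon_1(\infty)+\varepsilon_2(\infty)}-1\bigr)^j\bigr\}\Biggr).$$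
   Context: Rényi differential privacy: a randomized mechanism $\mathcal{M}$ with outputs in $\mathbb{R}^{k\times d}$ is $(\alpha,\varepsilon)$-RDP if for all adjacent datasets $D,D'$, $D_\alpha(\mathcal{M}(D)\|\mathcal{M}(D'))=\frac{1}{\alpha-1}\log\mathbb{E}_{o\sim\mathcal{M}(D)}\bigl[(\Pr(\mathcal{M}(D)=o)/\Pr(\mathcal{M}(D')=o))^{\alpha-1}\bigr]\le\varepsilon$ (with densities in place of probabilities for continuous outputs; order $\infty$ is understood as the limit). Two datasets (collections of clients) are adjacent if one is obtained from the other by adding or removing a single client (client-level privacy). RR-Cluster algorithm. There are $M$ clients and $k$ cluster models in $\mathbb{R}^d$. In each of the rounds $t=0,\dots,T-1$: (1) the server samples a subset $M^t$ of the clients with sampling rate $q$ (sampling without replacement); (2) the server sends the current cluster models $\{\hat\theta^t_j\}_{j\in[k]}$ to the sampled clients; each $i\in M^t$ returns a model update $\Delta\theta^t_i$ and clustering information $s_i$; (3) the server privatizes the $s_i$ into $\widetilde s_i$ and partitions $M^t$ into $k$ groups $S^t_1,\dots,S^t_k$ based on the $\widetilde s_i$; (4) rebalancing with threshold $B$, $1\le B\le qM/k$: clients are sampled uniformly at random from large groups and moved to small groups so that $|S^t_j|\ge B$ for all $j$; (5) updates are clipped, $\Delta\bar\theta^t_i=\Delta\theta_i^t/\max(1,\|\Delta\theta^t_i\|/C_\theta)$, and aggregated with Gaussian noise, $\Delta\widetilde\theta^t_j=\frac{1}{|S^t_j|}\bigl(\sum_{i\in S^t_j}\Delta\bar\theta^t_i+\mathcal{N}(0,(2C_\theta)^2\sigma_\theta^2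 I_d)\bigr)$; (6) $\hat\theta^{t+1}_j=\hat\theta^t_j+\gamma\Delta\widetilde\theta^t_j$. After $T$ rounds the $k$ cluster models are output. The single-round mechanism $\mathcal{M}$ consists of steps (2)–(6) with $M^t$ as input. The quantity $\varepsilon(\alpha)$ denotes the RDP parameter viewed as a function of the order $\alpha$.
   Formalization: The single-round mechanism is assumed RDP for samples of the fixed size ⌊qM⌋ that differ by exchanging one client (not by adding or removing one, for which the claim fails); the sample size stays ⌊qM⌋ for both adjacent populations, each having at least that many clients. *)

theory Defs
  imports "HOL-Probability.Probability"
begin

section \<open>Renyi divergence and Renyi differential privacy\<close>

definition ereal_exp :: "ereal \<Rightarrow> ereal" where
  "ereal_exp x =
    (if x = \<infinity> then \<infinity> else if x = -\<infinity> then 0 else ereal (exp (real_of_ereal x)))"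

definition ereal_ln :: "ereal \<Rightarrow> ereal" where
  "ereal_ln x =
    (if x = \<infinity> then \<infinity> else if x \<le> 0 then -\<infinity> else ereal (ln (real_of_ereal x)))"

text \<open>The likelihood ratio of \<open>P\<close> and \<open>Q\<close> is the Radon-Nikodym derivative. If \<open>P\<close> is not absolutely
  continuous with respect to \<open>Q\<close>, the ratio is infinite on a set of positive \<open>P\<close>-measure, so the
  divergence is infinite.\<close>

definition renyi_finite :: "real \<Rightarrow> 'b measure \<Rightarrow> 'b measure \<Rightarrow> ereal" where
  "renyi_finite \<alpha> P Q =
    (if absolutely_continuous Q P
     then ereal (1 / (\<alpha> - 1)) *
            ereal_ln (enn2ereal (\<integral>\<^sup>+ x. ennreal (enn2real (RN_deriv Q P x) powr (\<alpha> - 1)) \<partial>P))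
     else \<infinity>)"

definition renyi_divergence :: "ereal \<Rightarrow> 'b measure \<Rightarrow> 'b measure \<Rightarrow> ereal" where
  "renyi_divergence \<alpha> P Q =
    (if \<alpha> = \<infinity> then Lim at_top (\<lambda>a. renyi_finite a P Q)
     else renyi_finite (real_of_ereal \<alpha>) P Q)"

text \<open>A dataset is a set of clients; a client (an element of \<open>'c\<close>) comprises all of its data. The
  adjacency relation is a parameter because the whole algorithm runs on populations of varying
  size, while a single round runs on samples of one fixed size.\<close>

definition rdp :: "('c set \<Rightarrow> 'c set \<Rightarrow> bool) \<Rightarrow> ('c set \<Rightarrow> 'b measure) \<Rightarrow> ereal \<Rightarrow> ereal \<Rightarrow> bool" where
  "rdp adj mech \<alpha> \<epsilon> \<longleftrightarrow>
    (\<forall>D D'. adj D D' \<longrightarrow> renyi_divergence \<alpha> (mech D) (mech D') \<le> \<epsilon>)"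

definition add_remove :: "'c set \<Rightarrow> 'c set \<Rightarrow> bool" where
  "add_remove D D' \<longleftrightarrow> (\<exists>c. c \<notin> D \<and> D' = insert c D) \<or> (\<exists>c. c \<notin> D' \<and> D = insert c D')"

text \<open>Adjacent populations are populations of \<open>M\<close> clients together with those obtained from them by
  adding or removing one client, as long as \<open>m\<close> clients can be drawn without replacement.\<close>

definition population_adjacent :: "nat \<Rightarrow> nat \<Rightarrow> 'c set \<Rightarrow> 'c set \<Rightarrow> bool" where
  "population_adjacent m M D D' \<longleftrightarrow>
    add_remove D D' \<and> finite D \<and> finite D' \<and> (card D = M \<or> card D' = M) \<and>
    m \<le> card D \<and> m \<le> card D'"

text \<open>The effect of adding or removing a client of the population on a sample of the fixed size
  \<open>m\<close>: removing a sampled client makes room for another one, and an added client displaces a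
  sampled one.\<close>

definition sample_adjacent :: "nat \<Rightarrow> 'c set \<Rightarrow> 'c set \<Rightarrow> bool" where
  "sample_adjacent m S S' \<longleftrightarrow>
    card S = m \<and> card S' = m \<and>
    (\<exists>R c c'. finite R \<and> c \<notin> R \<and> c' \<notin> R \<and> c \<noteq> c' \<and> S = insert c R \<and> S' = insert c' R)"


section \<open>The RR-Cluster algorithm\<close>

type_synonym ('d, 'k) models = "((real, 'd) vec, 'k) vec"

text \<open>\<open>report i \<theta>\<close> is the joint law of the model update and the clustering information that client
  \<open>i\<close> returns on receiving the cluster models \<open>\<theta>\<close>. \<open>privatize S\<close> sends the information collected
  from the clients in \<open>S\<close> to the law of its privatized version, on which \<open>assign S\<close> bases the
  assignment of the clients to groups.\<close>

record ('c, 'd, 'k, 's, 'p) rr_cluster =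
  info_space :: "'s measure"
  private_space :: "'p measure"
  report :: "'c \<Rightarrow> ('d::finite, 'k::finite) models \<Rightarrow> ((real, 'd) vec \<times> 's) measure"
  privatize :: "'c set \<Rightarrow> ('c \<Rightarrow> 's) \<Rightarrow> ('c \<Rightarrow> 'p) measure"
  assign :: "'c set \<Rightarrow> ('c \<Rightarrow> 'p) \<Rightarrow> ('c \<Rightarrow> 'k)"
  threshold :: nat
  clip_norm :: real
  noise_mult :: real
  step_size :: real

definition wf_rr_cluster :: "('c, 'd::finite, 'k::finite, 's, 'p) rr_cluster \<Rightarrow> bool" where
  "wf_rr_cluster A \<longleftrightarrow>
    (\<forall>i. report A i \<in> borel \<rightarrow>\<^sub>M prob_algebra (borel \<Otimes>\<^sub>M info_space A)) \<and>
    (\<forall>S. finite S \<longrightarrow>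
      privatize A S \<in> (\<Pi>\<^sub>M i\<in>S. info_space A) \<rightarrow>\<^sub>M prob_algebra (\<Pi>\<^sub>M i\<in>S. private_space A) \<and>
      assign A S \<in> (\<Pi>\<^sub>M i\<in>S. private_space A) \<rightarrow>\<^sub>M count_space (S \<rightarrow>\<^sub>E UNIV)) \<and>
    1 \<le> threshold A \<and> 0 < clip_norm A \<and> 0 < noise_mult A"

definition group :: "'c set \<Rightarrow> ('c \<Rightarrow> 'k) \<Rightarrow> 'k \<Rightarrow> 'c set" where
  "group S a j = {i \<in> S. a i = j}"

text \<open>One client, drawn uniformly from the groups that exceed the threshold \<open>B\<close>, moves to a group
  below it.\<close>

definition rebalance_step :: "nat \<Rightarrow> 'c set \<Rightarrow> ('c \<Rightarrow> 'k::finite) \<Rightarrow> ('c \<Rightarrow> 'k) pmf" where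
  "rebalance_step B S a =
    (let large = {i \<in> S. card (group S a (a i)) > B};
         small = {j. card (group S a j) < B}
     in if large = {} \<or> small = {} then return_pmf a
        else map_pmf (\<lambda>(i, j). a(i := j)) (pmf_of_set (large \<times> small)))"

text \<open>Each step lowers the total deficit of the small groups by one, so that all groups have at
  least \<open>B\<close> members in the end if \<open>S\<close> has at least \<open>B\<close> clients per group.\<close>

definition rebalance :: "nat \<Rightarrow> 'c set \<Rightarrow> ('c \<Rightarrow> 'k::finite) \<Rightarrow> ('c \<Rightarrow> 'k) pmf" where
  "rebalance B S a =
    ((\<lambda>p. bind_pmf p (rebalance_step B S)) ^^ (\<Sum>j\<in>UNIV. B - card (group S a j))) (return_pmf a)"

definition clip :: "real \<Rightarrow> real ^ 'd \<Rightarrow> real ^ 'd" where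
  "clip C v = v /\<^sub>R max 1 (norm v / C)"

text \<open>Independent \<open>N(0, s\<^sup>2 I)\<close> vectors, one for each cluster.\<close>

definition gaussian_noise :: "real \<Rightarrow> ('d::finite, 'k::finite) models measure" where
  "gaussian_noise s =
    distr (\<Pi>\<^sub>M p\<in>(UNIV :: ('k \<times> 'd) set). density lborel (\<lambda>x. ennreal (normal_density 0 s x)))
      borel (\<lambda>f. \<chi> j l. f (j, l))"

definition aggregate_update ::
  "('c, 'd::finite, 'k::finite, 's, 'p) rr_cluster \<Rightarrow> 'c set \<Rightarrow> ('d, 'k) models \<Rightarrow>
    ('c \<Rightarrow> real ^ 'd) \<Rightarrow> ('c \<Rightarrow> 'k) \<Rightarrow> ('d, 'k) models \<Rightarrow> ('d, 'k) models" where
  "aggregate_update A S \<theta> \<Delta> a z =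
    (\<chi> j. \<theta> $ j + step_size A *\<^sub>R
        (((\<Sum>i\<in>group S a j. clip (clip_norm A) (\<Delta> i)) + z $ j) /\<^sub>R real (card (group S a j))))"

text \<open>The law of the new cluster models when the round starts from the models \<open>\<theta>\<close> and the clients
  in \<open>S\<close> have been selected.\<close>

definition single_round ::
  "('c, 'd::finite, 'k::finite, 's, 'p) rr_cluster \<Rightarrow> ('d, 'k) models \<Rightarrow> 'c set \<Rightarrow>
    ('d, 'k) models measure" where
  "single_round A \<theta> S =
    Giry_Monad.bind (\<Pi>\<^sub>M i\<in>S. report A i \<theta>) (\<lambda>r.
    Giry_Monad.bind (privatize A S (\<lambda>i\<in>S. snd (r i))) (\<lambda>s.
    Giry_Monad.bind (measure_pmf (rebalance (threshold A) S (assign A S s))) (\<lambda>a.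
      distr (gaussian_noise (2 * clip_norm A * noise_mult A)) borel
        (aggregate_update A S \<theta> (\<lambda>i. fst (r i)) a))))"

definition sample_size :: "real \<Rightarrow> nat \<Rightarrow> nat" where
  "sample_size q M = nat \<lfloor>q * real M\<rfloor>"

definition sample_clients :: "nat \<Rightarrow> 'c set \<Rightarrow> 'c set pmf" where
  "sample_clients m D = pmf_of_set {S. S \<subseteq> D \<and> card S = m}"

text \<open>\<open>T\<close> rounds on the population \<open>D\<close>, each with a fresh sample of \<open>m\<close> clients, started from the
  models \<open>\<theta>\<^sub>0\<close>.\<close>

primrec rr_cluster_run ::
  "('c, 'd::finite, 'k::finite, 's, 'p) rr_cluster \<Rightarrow> nat \<Rightarrow> ('d, 'k) models \<Rightarrow> nat \<Rightarrow> 'c set \<Rightarrow>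
    ('d, 'k) models measure" where
  "rr_cluster_run A m \<theta>\<^sub>0 0 D = return borel \<theta>\<^sub>0"
| "rr_cluster_run A m \<theta>\<^sub>0 (Suc t) D =
    Giry_Monad.bind (rr_cluster_run A m \<theta>\<^sub>0 t D) (\<lambda>\<theta>.
    Giry_Monad.bind (measure_pmf (sample_clients m D)) (\<lambda>S. single_round A \<theta> S))"

end

theory Submission
  imports Defs
begin

text \<open>
  Write the law of a round on one population as \<open>V\<close> and on the adjacent population as
  \<open>U = V + \<gamma> (P - P')\<close>, where \<open>P\<close> and \<open>P'\<close> average the laws of the round over coupled adjacent
  samples and \<open>\<gamma> \<le> q\<close> is the probability that the additional client is sampled. Expanding
  \<open>U ^ \<alpha> / V ^ (\<alpha> - 1)\<close> binomially, the linear term integrates to zero. By convexity of the perspective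
  \<open>(u, v) \<mapsto> u ^ j / v ^ (j - 1)\<close>, the \<open>j\<close>-th term is controlled by \<open>\<integral> |x - y| ^ j / y ^ (j - 1)\<close> for the
  densities \<open>x\<close>, \<open>y\<close> of a single adjacent pair, which the Renyi divergences of orders \<open>j\<close> and \<open>\<infinity>\<close>
  bound. The moments of order \<open>\<alpha>\<close> multiply along the rounds.\<close>

section \<open>Measurability of a single round\<close>

text \<open>The reference law \<open>V\<close> is the law on either the smaller or the larger
  population. On the larger one it is itself a mixture, with weight \<gamma> on the samples that
  contain the additional client, so both directions of adjacency reduce to one estimate whose
  denominator is a mixture with weight 0 or \<gamma>. Convexity then splits this denominator into
  the two members of each coupled pair. Pair bounds are therefore needed relative to either member,
  and the symmetry of \<open>sample_adjacent\<close> supplies them. Rounds are adaptive, since each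
  starts from the models released before. The moment bound of a round is uniform in these models, so
  it multiplies along the rounds without loss. The privacy parameters are extended reals of unknown
  sign. Infinite coefficients make the claim vacuous when there is at least one round; negative ones
  are excluded by exhibiting an adjacent pair of samples.\<close>

lemma measurable_bind_measure_pmf_finite:
  assumes fin: "finite (set_pmf p)"
    and g: "\<And>c. g c \<in> M \<rightarrow>\<^sub>M prob_algebra N"
  shows "(\<lambda>x. Giry_Monad.bind (measure_pmf p) (\<lambda>c. g c x)) \<in> M \<rightarrow>\<^sub>M prob_algebra N"
proof (rule measurable_prob_algebraI)
  have gx: "(\<lambda>c. g c x) \<in> measure_pmf p \<rightarrow>\<^sub>M prob_algebra N" if "x \<in> space M" for x
    using measurable_space[OF g that] by (auto simp: measurable_def)
  have gx': "(\<lambda>c. g c x) \<in> measure_pmf p \<rightarrow>\<^sub>M subprob_algebra N" if "x \<in> space M" for x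
    using gx[OF that] by (rule measurable_prob_algebraD)
  show prob: "prob_space (Giry_Monad.bind (measure_pmf p) (\<lambda>c. g c x))" if "x \<in> space M" for x
    using gx[OF that] measurable_space[OF g that]
    by (intro prob_space.prob_space_bind[OF _ _ gx'[OF that]] prob_space_measure_pmf)
      (auto simp: space_prob_algebra)
  show "(\<lambda>x. Giry_Monad.bind (measure_pmf p) (\<lambda>c. g c x)) \<in> M \<rightarrow>\<^sub>M subprob_algebra N"
  proof (rule measurable_subprob_algebra)
    fix x assume x: "x \<in> space M"
    then show "subprob_space (Giry_Monad.bind (measure_pmf p) (\<lambda>c. g c x))"
      by (intro prob_space_imp_subprob_space prob)
    show "sets (Giry_Monad.bind (measure_pmf p) (\<lambda>c. g c x)) = sets N"
      using measurable_space[OF g x] by (intro sets_bind) (auto simp: space_prob_algebra)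
  next
    fix E assume E: "E \<in> sets N"
    \<comment> \<open>Finite support turns the mixture into a finite sum of kernel values, so joint
      measurability in the index \<open>c\<close> does not enter.\<close>
    have eq: "emeasure (Giry_Monad.bind (measure_pmf p) (\<lambda>c. g c x)) E =
        (\<Sum>c\<in>set_pmf p. emeasure (g c x) E * ennreal (pmf p c))" if "x \<in> space M" for x
      using emeasure_bind[OF _ gx'[OF that] E] nn_integral_measure_pmf_finite[OF fin] by simp
    have "(\<lambda>x. \<Sum>c\<in>set_pmf p. emeasure (g c x) E * ennreal (pmf p c)) \<in> borel_measurable M"
      using g[THEN measurable_prob_algebraD] E
      by (intro borel_measurable_sum borel_measurable_times_ennreal borel_measurable_const
          measurable_compose[OF _ measurable_emeasure_subprob_algebra])
    then show "(\<lambda>x. emeasure (Giry_Monad.bind (measure_pmf p) (\<lambda>c. g c x)) E) \<in> borel_measurable M"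
      by (simp add: eq cong: measurable_cong)
  qed
qed

text \<open>Boxes form an intersection-stable generator, and the value of the product measure on a
  box is a finite product of values that are measurable in \<open>x\<close>.\<close>

lemma measurable_PiM_kernel:
  assumes I: "finite I" and K: "\<And>i. K i \<in> M \<rightarrow>\<^sub>M prob_algebra N"
  shows "(\<lambda>x. \<Pi>\<^sub>M i\<in>I. K i x) \<in> M \<rightarrow>\<^sub>M prob_algebra (\<Pi>\<^sub>M i\<in>I. N)"
proof (rule measurable_prob_algebra_generated[OF sets_PiM Int_stable_prod_algebra prod_algebra_sets_into_space])
  have prob: "prob_space (K i x)" and sets: "sets (K i x) = sets N" if "x \<in> space M" for i x
    using measurable_space[OF K that] by (auto simp: space_prob_algebra)
  fix x assume x: "x \<in> space M"
  show "prob_space (\<Pi>\<^sub>M i\<in>I. K i x)"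
    using prob[OF x] by (rule prob_space_PiM)
  show "sets (\<Pi>\<^sub>M i\<in>I. K i x) = sets (\<Pi>\<^sub>M i\<in>I. N)"
    using sets[OF x] by (intro sets_PiM_cong) auto
next
  have prob: "prob_space (K i x)" and sets: "sets (K i x) = sets N" if "x \<in> space M" for i x
    using measurable_space[OF K that] by (auto simp: space_prob_algebra)
  fix E assume "E \<in> prod_algebra I (\<lambda>i. N)"
  then obtain B where E: "E = (\<Pi>\<^sub>E i\<in>I. B i)" and B: "\<And>i. i \<in> I \<Longrightarrow> B i \<in> sets N"
    using I by (auto simp: prod_algebra_eq_finite)
  have eq: "emeasure (\<Pi>\<^sub>M i\<in>I. K i x) E = (\<Prod>i\<in>I. emeasure (K i x) (B i))" if "x \<in> space M" for x
  proof -
    interpret product_sigma_finite "\<lambda>i. K i x"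
      using prob[OF that] by (simp add: product_sigma_finite_def prob_space_imp_sigma_finite)
    show ?thesis unfolding E using I B sets[OF that] by (intro emeasure_PiM) auto
  qed
  have "(\<lambda>x. \<Prod>i\<in>I. emeasure (K i x) (B i)) \<in> borel_measurable M"
    using K[THEN measurable_prob_algebraD] B
    by (intro borel_measurable_prod_ennreal measurable_compose[OF _ measurable_emeasure_subprob_algebra])
  then show "(\<lambda>x. emeasure (\<Pi>\<^sub>M i\<in>I. K i x) E) \<in> borel_measurable M"
    by (simp add: eq cong: measurable_cong)
qed

section \<open>Coordinatewise measurability of vectors and models\<close>

lemma borel_measurable_vec_iff:
  fixes f :: "'a \<Rightarrow> ('b::euclidean_space) ^ 'n::finite"
  shows "f \<in> borel_measurable M \<longleftrightarrow> (\<forall>i. (\<lambda>x. f x $ i) \<in> borel_measurable M)"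
proof
  assume "f \<in> borel_measurable M"
  then show "\<forall>i. (\<lambda>x. f x $ i) \<in> borel_measurable M"
    using measurable_compose[OF _ borel_measurable_continuous_onI[OF continuous_on_component[OF continuous_on_id]]]
    by auto
next
  assume *: "\<forall>i. (\<lambda>x. f x $ i) \<in> borel_measurable M"
  show "f \<in> borel_measurable M"
  proof (subst borel_measurable_euclidean_space, rule ballI)
    fix b :: "'b ^ 'n" assume "b \<in> Basis"
    then obtain i u where "b = axis i u" by (auto simp: Basis_vec_def)
    then show "(\<lambda>x. f x \<bullet> b) \<in> borel_measurable M"
      using * by (auto simp: inner_axis intro!: borel_measurable_inner)
  qed
qed

lemma measurable_vec_nth [measurable (raw)]:
  fixes f :: "'a \<Rightarrow> ('b::euclidean_space) ^ 'n::finite"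
  shows "f \<in> borel_measurable M \<Longrightarrow> (\<lambda>x. f x $ i) \<in> borel_measurable M"
  by (simp add: borel_measurable_vec_iff)

lemma measurable_vec_lambda [measurable (raw)]:
  fixes f :: "'n::finite \<Rightarrow> 'a \<Rightarrow> ('b::euclidean_space)"
  shows "(\<And>i. f i \<in> borel_measurable M) \<Longrightarrow> (\<lambda>x. \<chi> i. f i x) \<in> borel_measurable M"
  by (simp add: borel_measurable_vec_iff)

lemma measurable_clip [measurable]: "clip C \<in> borel_measurable borel"
  unfolding clip_def by measurable

lemma gaussian_noise_in_prob_algebra:
  assumes "0 < s"
  shows "(gaussian_noise s :: ('d::finite, 'k::finite) models measure) \<in> space (prob_algebra borel)"
proof -
  have m: "(\<lambda>f. \<chi> j l. f (j, l) :: ('d, 'k) models) \<in>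
      (\<Pi>\<^sub>M p\<in>(UNIV :: ('k \<times> 'd) set). density lborel (\<lambda>x. ennreal (normal_density 0 s x))) \<rightarrow>\<^sub>M borel"
    by (intro measurable_vec_lambda) (subst measurable_cong_sets[OF sets_PiM_cong refl, of _ UNIV _ "\<lambda>_. borel"]; simp)
  show ?thesis unfolding gaussian_noise_def space_prob_algebra
    using prob_space_normal_density[OF assms]
    by (auto intro!: prob_space.prob_space_distr[OF _ m] prob_space_PiM)
qed

section \<open>Rebalanced assignments range over a finite set\<close>

lemma rebalance_step_support:
  assumes "finite S" "a \<in> S \<rightarrow>\<^sub>E UNIV"
  shows "set_pmf (rebalance_step B S a) \<subseteq> S \<rightarrow>\<^sub>E UNIV"
proof -
  let ?large = "{i \<in> S. card (group S a (a i)) > B}" and ?small = "{j. card (group S a j) < B}"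
  show ?thesis
  proof (cases "?large = {} \<or> ?small = {}")
    case False
    then have "set_pmf (pmf_of_set (?large \<times> ?small)) = ?large \<times> ?small"
      using assms by (intro set_pmf_of_set) auto
    then show ?thesis using False assms by (auto simp: rebalance_step_def Let_def)
  qed (use assms in \<open>auto simp: rebalance_step_def Let_def\<close>)
qed

text \<open>Extensional assignments on a finite \<open>S\<close> are finite in number, so averaging
  over the rebalanced assignment is a finite mixture and falls under
  \<open>measurable_bind_measure_pmf_finite\<close>.\<close>

lemma rebalance_support:
  assumes "finite S" "a \<in> S \<rightarrow>\<^sub>E UNIV"
  shows "set_pmf (rebalance B S a) \<subseteq> S \<rightarrow>\<^sub>E UNIV"
proof -
  \<comment> \<open>The number of iterations depends on the initial assignment, so the invariant is
    shown for every number \<open>n\<close>.\<close>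
  have "set_pmf (((\<lambda>p. bind_pmf p (rebalance_step B S)) ^^ n) (return_pmf a)) \<subseteq> S \<rightarrow>\<^sub>E UNIV" for n
  proof (induction n)
    case (Suc n)
    then show ?case using rebalance_step_support[OF assms(1)] by (auto simp del: PiE_iff) blast
  qed (use assms in auto)
  then show ?thesis unfolding rebalance_def .
qed

lemma measurable_aggregate_update:
  fixes A :: "('c, 'd::finite, 'k::finite, 's, 'p) rr_cluster"
  assumes "finite S" "\<theta> \<in> borel_measurable M" "\<And>i. i \<in> S \<Longrightarrow> (\<lambda>x. \<Delta> x i) \<in> borel_measurable M"
    "z \<in> borel_measurable M"
  shows "(\<lambda>x. aggregate_update A S (\<theta> x) (\<Delta> x) a (z x)) \<in> borel_measurable M"
  unfolding aggregate_update_def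
  by (intro measurable_vec_lambda borel_measurable_add borel_measurable_scaleR borel_measurable_const
      borel_measurable_sum measurable_vec_nth assms measurable_compose[OF _ measurable_clip])
    (auto simp: group_def)

lemma measurable_single_round:
  fixes A :: "('c, 'd::finite, 'k::finite, 's, 'p) rr_cluster"
  assumes wf: "wf_rr_cluster A" and S: "finite S"
  shows "(\<lambda>\<theta>. single_round A \<theta> S) \<in> borel \<rightarrow>\<^sub>M prob_algebra borel"
proof -
  have report: "report A i \<in> borel \<rightarrow>\<^sub>M prob_algebra (borel \<Otimes>\<^sub>M info_space A)" for i
    using wf by (simp add: wf_rr_cluster_def)
  have privatize [measurable]: "privatize A S \<in> (\<Pi>\<^sub>M i\<in>S. info_space A) \<rightarrow>\<^sub>M prob_algebra (\<Pi>\<^sub>M i\<in>S. private_space A)"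
    and assign: "assign A S \<in> (\<Pi>\<^sub>M i\<in>S. private_space A) \<rightarrow>\<^sub>M count_space (S \<rightarrow>\<^sub>E UNIV)"
    using wf S by (auto simp: wf_rr_cluster_def)
  let ?R = "\<Pi>\<^sub>M i\<in>S. borel \<Otimes>\<^sub>M info_space A" and ?P = "\<Pi>\<^sub>M i\<in>S. private_space A"
  let ?g = "gaussian_noise (2 * clip_norm A * noise_mult A) :: ('d, 'k) models measure"
  let ?G = "\<lambda>\<theta> r a. distr ?g borel (aggregate_update A S \<theta> (\<lambda>i. fst (r i)) a)"
  have g: "?g \<in> space (prob_algebra borel)"
    using wf by (intro gaussian_noise_in_prob_algebra) (auto simp: wf_rr_cluster_def)
  have fin: "finite (S \<rightarrow>\<^sub>E (UNIV :: 'k set))"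
    using S by (intro finite_PiE) auto
  have upd: "(\<lambda>(((\<theta>, r), s), z). aggregate_update A S \<theta> (\<lambda>i. fst (r i)) a z) \<in>
      borel_measurable (((borel \<Otimes>\<^sub>M ?R) \<Otimes>\<^sub>M ?P) \<Otimes>\<^sub>M borel)" for a
    unfolding split_beta by (intro measurable_aggregate_update S) measurable
  have G: "(\<lambda>((\<theta>, r), s). ?G \<theta> r a) \<in> (borel \<Otimes>\<^sub>M ?R) \<Otimes>\<^sub>M ?P \<rightarrow>\<^sub>M prob_algebra borel" for a
    unfolding split_beta
    using upd[unfolded split_beta] g
    by (intro measurable_distr_prob_space2[where M = borel]) (auto simp: split_beta)
  let ?B = "\<lambda>b \<theta> r. Giry_Monad.bind (measure_pmf (rebalance (threshold A) S b)) (?G \<theta> r)"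
  have B: "(\<lambda>x. ?B b (fst (fst x)) (snd (fst x))) \<in> (borel \<Otimes>\<^sub>M ?R) \<Otimes>\<^sub>M ?P \<rightarrow>\<^sub>M prob_algebra borel"
    if "b \<in> S \<rightarrow>\<^sub>E UNIV" for b
    using G[unfolded split_beta] finite_subset[OF rebalance_support[OF S that] fin]
    by (intro measurable_bind_measure_pmf_finite) auto
  \<comment> \<open>The privatized information enters only through the assignment, which has
    finitely many values, so the kernels \<open>?B b\<close> with fixed \<open>b\<close> can be
    glued together.\<close>
  have "(\<lambda>x. ?B (assign A S (snd x)) (fst (fst x)) (snd (fst x))) \<in>
      (borel \<Otimes>\<^sub>M ?R) \<Otimes>\<^sub>M ?P \<rightarrow>\<^sub>M prob_algebra borel"
    by (rule measurable_compose_countable'[OF B measurable_compose[OF measurable_snd assign]])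
      (use fin in \<open>auto intro: countable_finite\<close>)
  then have "(\<lambda>(x, s). ?B (assign A S s) (fst x) (snd x)) \<in> (borel \<Otimes>\<^sub>M ?R) \<Otimes>\<^sub>M ?P \<rightarrow>\<^sub>M prob_algebra borel"
    by (simp add: split_beta)
  moreover have "(\<lambda>x. privatize A S (\<lambda>i\<in>S. snd (snd x i))) \<in> borel \<Otimes>\<^sub>M ?R \<rightarrow>\<^sub>M prob_algebra ?P"
    by (rule measurable_compose[OF _ privatize]) measurable
  ultimately have "(\<lambda>x. Giry_Monad.bind (privatize A S (\<lambda>i\<in>S. snd (snd x i)))
      (\<lambda>s. ?B (assign A S s) (fst x) (snd x))) \<in> borel \<Otimes>\<^sub>M ?R \<rightarrow>\<^sub>M prob_algebra borel"
    by (rule measurable_bind_prob_space2[rotated])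
  then have "(\<lambda>(\<theta>, r). Giry_Monad.bind (privatize A S (\<lambda>i\<in>S. snd (r i)))
      (\<lambda>s. ?B (assign A S s) \<theta> r)) \<in> borel \<Otimes>\<^sub>M ?R \<rightarrow>\<^sub>M prob_algebra borel"
    by (simp add: split_beta)
  with measurable_PiM_kernel[OF S report] show ?thesis
    unfolding single_round_def by (rule measurable_bind_prob_space2)
qed

section \<open>Rounds with a random sample\<close>

text \<open>\<open>Giry_Monad.bind\<close> reads its target space off one arbitrary element, which
  may lie outside the support. The first hypothesis controls this element; everything else is
  decided on the support.\<close>

lemma bind_measure_pmf_cong_support:
  assumes f: "sets (f (SOME x. True)) = sets N"
    and g: "\<And>x. sets (g x) = sets N"
    and eq: "\<And>x. x \<in> set_pmf p \<Longrightarrow> f x = g x"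
  shows "Giry_Monad.bind (measure_pmf p) f = Giry_Monad.bind (measure_pmf p) g"
proof -
  have "emeasure (measure_pmf p) (f -` E) = emeasure (measure_pmf p) (g -` E)" for E
    using eq by (intro emeasure_eq_AE) (auto simp: AE_measure_pmf_iff)
  then have "distr (measure_pmf p) (subprob_algebra N) f = distr (measure_pmf p) (subprob_algebra N) g"
    by (simp add: distr_def)
  moreover have "subprob_algebra (f (SOME x. True)) = subprob_algebra N"
    "subprob_algebra (g (SOME x. True)) = subprob_algebra N"
    using f g by (auto intro: subprob_algebra_cong)
  ultimately show ?thesis by (simp add: bind_def)
qed

lemma sets_bind_SOME:
  "space M \<noteq> {} \<Longrightarrow> sets (Giry_Monad.bind M f) = sets (f (SOME x. x \<in> space M))"
  by (simp add: bind_nonempty)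

text \<open>On an infinite \<open>S\<close>, the measure \<open>privatize A S s\<close> is unconstrained and may live on the empty
  space. Since \<open>Giry_Monad.bind\<close> takes its target space from an arbitrary element, this matters for
  rounds with a random sample even though all samples are finite.\<close>

lemma single_round_space_dichotomy:
  fixes A :: "('c, 'd::finite, 'k::finite, 's, 'p) rr_cluster"
  assumes wf: "wf_rr_cluster A"
  shows "(\<forall>\<theta>. sets (single_round A \<theta> S) = sets borel) \<or> (\<forall>\<theta>. space (single_round A \<theta> S) = {})"
proof -
  let ?R = "\<Pi>\<^sub>M i\<in>S. borel \<Otimes>\<^sub>M info_space A :: ((real, 'd) vec \<times> 's) measure"
  \<comment> \<open>The report at which \<open>bind\<close> inspects its continuation. The space of
    reports does not depend on \<theta>, so the same element serves all \<theta>, and the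
    alternative is uniform in \<theta>.\<close>
  define r\<^sub>0 where "r\<^sub>0 = (SOME r. r \<in> space ?R)"
  define M where "M = privatize A S (\<lambda>i\<in>S. snd (r\<^sub>0 i))"
  have report: "sets (report A i \<theta>) = sets (borel \<Otimes>\<^sub>M info_space A)" "prob_space (report A i \<theta>)" for i \<theta>
    using wf measurable_space[of "report A i" borel "prob_algebra (borel \<Otimes>\<^sub>M info_space A)" \<theta>]
    by (auto simp: wf_rr_cluster_def space_prob_algebra)
  have R: "space (\<Pi>\<^sub>M i\<in>S. report A i \<theta>) = space ?R" for \<theta>
    by (intro sets_eq_imp_space_eq sets_PiM_cong report refl)
  have ne: "space (\<Pi>\<^sub>M i\<in>S. report A i \<theta>) \<noteq> {}" for \<theta>
    using prob_space.not_empty[OF report(2)] by (auto simp: space_PiM PiE_eq_empty_iff)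
  have *: "sets (single_round A \<theta> S) = sets (Giry_Monad.bind M (\<lambda>s.
      Giry_Monad.bind (measure_pmf (rebalance (threshold A) S (assign A S s))) (\<lambda>a.
        distr (gaussian_noise (2 * clip_norm A * noise_mult A)) borel
          (aggregate_update A S \<theta> (\<lambda>i. fst (r\<^sub>0 i)) a))))" for \<theta>
    unfolding single_round_def sets_bind_SOME[OF ne] M_def r\<^sub>0_def R ..
  show ?thesis
  proof (cases "space M = {}")
    case True
    then have "sets (single_round A \<theta> S) = sets (count_space {})" for \<theta>
      unfolding * by (subst bind_empty) auto
    then have "space (single_round A \<theta> S) = {}" for \<theta>
      using sets_eq_imp_space_eq[of "single_round A \<theta> S" "count_space {}"] by simp
    then show ?thesis by blast
  next
    case False
    have "sets (single_round A \<theta> S) = sets borel" for \<theta>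
      unfolding * by (subst sets_bind_SOME[OF False], subst sets_bind_SOME) auto
    then show ?thesis by blast
  qed
qed

text \<open>Samples from a finite population are finite. Giving infinite sets the law
  \<open>return borel \<theta>\<close> makes every component of the mixture a probability kernel,
  which \<open>single_round\<close> alone does not guarantee.\<close>

definition sampled_round ::
  "('c, 'd::finite, 'k::finite, 's, 'p) rr_cluster \<Rightarrow> 'c set pmf \<Rightarrow> ('d, 'k) models \<Rightarrow> ('d, 'k) models measure" where
  "sampled_round A p \<theta> = Giry_Monad.bind (measure_pmf p)
    (\<lambda>S. if finite S then single_round A \<theta> S else return borel \<theta>)"

lemma single_round_or_return_in_prob_algebra:
  assumes "wf_rr_cluster A"
  shows "(\<lambda>\<theta>. if finite S then single_round A \<theta> S else return borel \<theta>) \<in> borel \<rightarrow>\<^sub>M prob_algebra borel"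
  using measurable_single_round[OF assms, of S] by (cases "finite S") auto

lemma measurable_sampled_round:
  assumes "wf_rr_cluster A" "finite (set_pmf p)"
  shows "sampled_round A p \<in> borel \<rightarrow>\<^sub>M prob_algebra borel"
  unfolding sampled_round_def[abs_def]
  by (intro measurable_bind_measure_pmf_finite single_round_or_return_in_prob_algebra assms)

lemma finite_set_pmf_sample_clients:
  assumes "finite D" "m \<le> card D"
  shows "finite (set_pmf (sample_clients m D))" "set_pmf (sample_clients m D) = {S. S \<subseteq> D \<and> card S = m}"
proof -
  have "{S. S \<subseteq> D \<and> card S = m} \<noteq> {}"
    using obtain_subset_with_card_n[OF assms(2)] by auto
  moreover have "finite {S. S \<subseteq> D \<and> card S = m}" using assms by auto
  ultimately show "set_pmf (sample_clients m D) = {S. S \<subseteq> D \<and> card S = m}"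
    unfolding sample_clients_def by (rule set_pmf_of_set)
  with assms show "finite (set_pmf (sample_clients m D))" by auto
qed

lemma rr_cluster_run_regular:
  assumes wf: "wf_rr_cluster A" and D: "finite D" "m \<le> card D"
    and reg: "\<And>\<theta>. sets (single_round A \<theta> (SOME S. True)) = sets borel"
  shows "rr_cluster_run A m \<theta>\<^sub>0 (Suc t) D =
    Giry_Monad.bind (rr_cluster_run A m \<theta>\<^sub>0 t D) (sampled_round A (sample_clients m D))"
proof -
  have "sets (single_round A \<theta> S) = sets borel" if "finite S" for \<theta> S
    using measurable_space[OF measurable_single_round[OF wf that], of \<theta>] by (auto simp: space_prob_algebra)
  then have "Giry_Monad.bind (measure_pmf (sample_clients m D)) (single_round A \<theta>) =
      sampled_round A (sample_clients m D) \<theta>" for \<theta>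
    unfolding sampled_round_def using finite_set_pmf_sample_clients[OF D] D
    by (intro bind_measure_pmf_cong_support[where N = borel] reg) (auto dest: finite_subset)
  then show ?thesis by simp
qed

lemma rr_cluster_run_in_prob_algebra:
  assumes "wf_rr_cluster A" "finite D" "m \<le> card D"
    and "\<And>\<theta>. sets (single_round A \<theta> (SOME S. True)) = sets borel"
  shows "rr_cluster_run A m \<theta>\<^sub>0 t D \<in> space (prob_algebra borel)"
proof (induction t)
  case 0
  then show ?case by (simp add: space_prob_algebra prob_space_return)
next
  case (Suc t)
  have "sampled_round A (sample_clients m D) \<in> borel \<rightarrow>\<^sub>M prob_algebra borel"
    using assms finite_set_pmf_sample_clients(1) by (intro measurable_sampled_round)
  from prob_space_bind'[OF Suc this] sets_bind'[OF Suc this] show ?case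
    unfolding rr_cluster_run_regular[OF assms] space_prob_algebra by blast
qed

lemma space_rr_cluster_run_degenerate:
  assumes "\<And>\<theta>. space (single_round A \<theta> (SOME S. True)) = {}"
  shows "space (rr_cluster_run A m \<theta>\<^sub>0 (Suc t) D) = {}"
proof -
  have *: "space (Giry_Monad.bind (measure_pmf p) (single_round A \<theta>)) = {}" for p \<theta>
    using assms sets_eq_imp_space_eq[OF sets_bind_SOME[of "measure_pmf p" "single_round A \<theta>"]] by simp
  show ?thesis
  proof (cases "space (rr_cluster_run A m \<theta>\<^sub>0 t D) = {}")
    case False
    show ?thesis unfolding rr_cluster_run.simps sets_eq_imp_space_eq[OF sets_bind_SOME[OF False]] by (rule *)
  qed (simp add: space_bind_empty)
qed

text \<open>Integrals over the empty space vanish and the logarithm of 0 is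
  \<open>-\<infinity>\<close>, so a degenerate run satisfies every privacy bound.\<close>

lemma renyi_finite_empty_space:
  assumes "space P = {}" "space Q = {}" "1 < \<alpha>"
  shows "renyi_finite \<alpha> P Q = -\<infinity>"
proof -
  have "null_sets Q \<subseteq> null_sets P"
  proof
    fix X assume "X \<in> null_sets Q"
    then have "X = {}" using assms(2) sets.sets_into_space[of X Q] by (auto simp: null_sets_def)
    then show "X \<in> null_sets P" by simp
  qed
  moreover have "(\<integral>\<^sup>+ x. f x \<partial>P) = 0" for f
    using assms(1) by (subst nn_integral_cong[of P f "\<lambda>_. 0"]) auto
  ultimately show ?thesis
    using assms(3) by (simp add: renyi_finite_def absolutely_continuous_def ereal_ln_def zero_ennreal.rep_eq)
qed

section \<open>Moments of likelihood ratios and their composition\<close>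

text \<open>Convexity: \<open>u ^ Suc n\<close> lies above its tangent at \<open>t\<close>. All uses
  of Hoelder's inequality and of joint convexity below come down to this inequality, which is linear
  in \<open>u\<close> and leaves \<open>t\<close> to be chosen after integrating or summing.\<close>

lemma power_tangent:
  fixes u t :: real
  assumes "0 \<le> u" "0 \<le> t"
  shows "real (Suc n) * t ^ n * u \<le> u ^ Suc n + real n * t ^ Suc n"
proof (induction n)
  case (Suc n)
  \<comment> \<open>The gap for the next exponent is \<open>u\<close> times the present gap plus a
    multiple of a square.\<close>
  have "u ^ Suc (Suc n) + real (Suc n) * t ^ Suc (Suc n) - real (Suc (Suc n)) * t ^ Suc n * u =
      u * (u ^ Suc n + real n * t ^ Suc n - real (Suc n) * t ^ n * u) + real (Suc n) * t ^ n * (t - u)\<^sup>2"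
    by (simp add: power2_eq_square algebra_simps)
  also have "\<dots> \<ge> 0"
    using Suc assms by (intro add_nonneg_nonneg mult_nonneg_nonneg) auto
  finally show ?case by simp
qed simp

text \<open>The tangent inequalities for all \<open>t\<close> form an envelope; the best choice is
  \<open>t = A / B\<close>. If \<open>B = 0\<close>, letting \<open>t\<close> grow forces
  \<open>A = 0\<close>.\<close>

lemma Hoelder_from_tangents:
  fixes A B C :: real
  assumes n: "0 < n" and nonneg: "0 \<le> A" "0 \<le> B" "0 \<le> C"
    and tangent: "\<And>t. 0 \<le> t \<Longrightarrow> real (Suc n) * t ^ n * A \<le> C + real n * t ^ Suc n * B"
  shows "A ^ Suc n \<le> C * B ^ n"
proof (cases "B = 0")
  case True
  have "A = 0"
  proof (rule ccontr)
    assume "A \<noteq> 0"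
    then have A: "A > 0" using nonneg by simp
    \<comment> \<open>Chosen so that \<open>t * A = C + A\<close>, which exceeds
      \<open>C\<close>.\<close>
    define t where "t = (C + A) / A"
    have "t \<ge> 1" using A nonneg by (simp add: t_def field_simps)
    then have "t \<le> t ^ n" using n by (simp add: self_le_power)
    then have "t * A \<le> t ^ n * A" using A by (intro mult_right_mono) auto
    moreover have "1 * (t ^ n * A) \<le> real (Suc n) * (t ^ n * A)"
      using A \<open>t \<ge> 1\<close> by (intro mult_right_mono) auto
    moreover have "real (Suc n) * t ^ n * A \<le> C" using tangent[of t] \<open>t \<ge> 1\<close> True by simp
    ultimately have "t * A \<le> C" by (simp add: mult.assoc)
    then show False using A by (simp add: t_def)
  qed
  then show ?thesis using nonneg by simp
next
  case False
  then have B: "B > 0" using nonneg by simp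
  have "real (Suc n) * (A / B) ^ n * A \<le> C + real n * ((A / B) ^ n * (A / B)) * B"
    using tangent[of "A / B"] nonneg by (simp add: mult.commute)
  also have "real n * ((A / B) ^ n * (A / B)) * B = real n * (A / B) ^ n * A" using B by simp
  finally have "(A / B) ^ n * A \<le> C" by (simp add: algebra_simps)
  then show ?thesis using B by (simp add: field_simps power_divide)
qed

lemma prob_integrable_bounded:
  fixes h :: "'a \<Rightarrow> real"
  assumes "P \<in> space (prob_algebra N)" "h \<in> borel_measurable N" "\<And>x. 0 \<le> h x \<and> h x \<le> K"
  shows "integrable P (\<lambda>x. h x ^ n)"
proof -
  interpret prob_space P using assms by (simp add: space_prob_algebra)
  have "h \<in> borel_measurable P" using assms by (simp add: space_prob_algebra cong: measurable_cong_sets)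
  then show ?thesis using assms(3)
    by (intro integrable_const_bound[where B = "K ^ n"]) (auto intro: power_mono)
qed

text \<open>The moment \<open>\<integral> (dP/dQ) ^ Suc n dQ\<close> is at most \<open>C\<close>, in the dual form given by
  Hoelder's inequality. Unlike the moment itself, this form passes through kernels without any
  joint measurability of Radon-Nikodym derivatives.\<close>

definition moment_bound :: "nat \<Rightarrow> real \<Rightarrow> 'b measure \<Rightarrow> 'b measure \<Rightarrow> bool" where
  "moment_bound n C P Q \<longleftrightarrow>
    (\<forall>h\<in>borel_measurable Q. \<forall>K. (\<forall>x. 0 \<le> h x \<and> h x \<le> K) \<longrightarrow>
      (\<integral>x. h x ^ n \<partial>P) ^ Suc n \<le> C * (\<integral>x. h x ^ Suc n \<partial>Q) ^ n)"

lemma moment_bound_self: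
  assumes "0 < n" "P \<in> space (prob_algebra N)"
  shows "moment_bound n 1 P P"
  unfolding moment_bound_def
proof (intro ballI allI impI)
  interpret prob_space P using assms by (simp add: space_prob_algebra)
  fix h :: "'a \<Rightarrow> real" and K
  assume h: "h \<in> borel_measurable P" "\<forall>x. 0 \<le> h x \<and> h x \<le> K"
  have P: "P \<in> space (prob_algebra P)" by (simp add: space_prob_algebra prob_space_axioms)
  note int = prob_integrable_bounded[OF P h(1) h(2)[rule_format]]
  show "(\<integral>x. h x ^ n \<partial>P) ^ Suc n \<le> 1 * (\<integral>x. h x ^ Suc n \<partial>P) ^ n"
  proof (rule Hoelder_from_tangents)
    fix t :: real assume t: "0 \<le> t"
    have "(\<integral>x. real (Suc n) * t ^ n * h x ^ n \<partial>P) \<le> (\<integral>x. 1 + real n * t ^ Suc n * h x ^ Suc n \<partial>P)"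
    proof (rule integral_mono)
      fix x
      show "real (Suc n) * t ^ n * h x ^ n \<le> 1 + real n * t ^ Suc n * h x ^ Suc n"
        using power_tangent[of 1 "t * h x" n] t h(2) by (simp add: power_mult_distrib algebra_simps)
    qed (use int in \<open>auto intro!: Bochner_Integration.integrable_add integrable_mult_right simp del: power_Suc\<close>)
    also have "\<dots> = 1 + real n * t ^ Suc n * (\<integral>x. h x ^ Suc n \<partial>P)"
      using int by (subst Bochner_Integration.integral_add) (auto simp: prob_space simp del: power_Suc)
    finally show "real (Suc n) * t ^ n * (\<integral>x. h x ^ n \<partial>P) \<le> 1 + real n * t ^ Suc n * (\<integral>x. h x ^ Suc n \<partial>P)"
      by simp
  qed (use h assms in auto)
qed

text \<open>Apply \<open>power_tangent\<close> to the ratio \<open>U x / V x\<close> at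
  \<open>t * h x\<close>, multiply by \<open>V x\<close> and integrate. Because division by 0 yields
  0, the integrand would ignore mass of \<open>U\<close> on the zeros of \<open>V\<close>;
  \<open>ac\<close> excludes such mass.\<close>

lemma moment_bound_density:
  fixes U V :: "'a \<Rightarrow> real"
  assumes n: "0 < n"
    and U [measurable]: "U \<in> borel_measurable M" and U0: "\<And>x. 0 \<le> U x"
    and V [measurable]: "V \<in> borel_measurable M" and V0: "\<And>x. 0 \<le> V x"
    and P: "P = density M U" "prob_space P" and Q: "Q = density M V" "prob_space Q"
    and ac: "AE x in M. V x = 0 \<longrightarrow> U x = 0"
    and int: "integrable M (\<lambda>x. U x ^ Suc n / V x ^ n)" and C: "(\<integral>x. U x ^ Suc n / V x ^ n \<partial>M) \<le> C"
  shows "moment_bound n C P Q"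
  unfolding moment_bound_def
proof (intro ballI allI impI)
  fix h :: "'a \<Rightarrow> real" and K
  assume "h \<in> borel_measurable Q" and h: "\<forall>x. 0 \<le> h x \<and> h x \<le> K"
  then have h_meas [measurable]: "h \<in> borel_measurable M" by (simp add: Q)
  have "P \<in> space (prob_algebra M)" "Q \<in> space (prob_algebra M)"
    using P Q by (auto simp: space_prob_algebra)
  note intP = prob_integrable_bounded[OF this(1) h_meas h[rule_format]]
    and intQ = prob_integrable_bounded[OF this(2) h_meas h[rule_format]]
  have intU: "integrable M (\<lambda>x. U x * h x ^ k)" and intV: "integrable M (\<lambda>x. V x * h x ^ k)" for k
    using intP[of k] intQ[of k] U0 V0 by (auto simp: P Q integrable_density)
  have A: "(\<integral>x. h x ^ k \<partial>P) = (\<integral>x. U x * h x ^ k \<partial>M)" and B: "(\<integral>x. h x ^ k \<partial>Q) = (\<integral>x. V x * h x ^ k \<partial>M)" for k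
    using U0 V0 by (auto simp: P Q integral_density)
  have C0: "0 \<le> (\<integral>x. U x ^ Suc n / V x ^ n \<partial>M)" using U0 V0 by (intro integral_nonneg_AE) auto
  show "(\<integral>x. h x ^ n \<partial>P) ^ Suc n \<le> C * (\<integral>x. h x ^ Suc n \<partial>Q) ^ n"
  proof (rule Hoelder_from_tangents[OF n])
    fix t :: real assume t: "0 \<le> t"
    have "(\<integral>x. real (Suc n) * t ^ n * (U x * h x ^ n) \<partial>M) \<le>
        (\<integral>x. U x ^ Suc n / V x ^ n + real n * t ^ Suc n * (V x * h x ^ Suc n) \<partial>M)"
    proof (rule integral_mono_AE)
      show "AE x in M. real (Suc n) * t ^ n * (U x * h x ^ n) \<le>
          U x ^ Suc n / V x ^ n + real n * t ^ Suc n * (V x * h x ^ Suc n)"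
        using ac
      proof eventually_elim
        case (elim x)
        show ?case
        proof (cases "V x = 0")
          case False
          then have v: "V x > 0" using V0[of x] by simp
          have "real (Suc n) * (t * h x) ^ n * (U x / V x) \<le> (U x / V x) ^ Suc n + real n * (t * h x) ^ Suc n"
            using t h U0 v by (intro power_tangent) auto
          then have "V x * (real (Suc n) * (t * h x) ^ n * (U x / V x)) \<le>
              V x * ((U x / V x) ^ Suc n + real n * (t * h x) ^ Suc n)"
            using v by (intro mult_left_mono) auto
          then show ?thesis using v by (simp add: power_divide power_mult_distrib distrib_left mult_ac del: of_nat_Suc)
        qed (use elim in simp)
      qed
    qed (use int intU intV in \<open>auto intro!: Bochner_Integration.integrable_add integrable_mult_right simp del: power_Suc\<close>)
    also have "\<dots> = (\<integral>x. U x ^ Suc n / V x ^ n \<partial>M) + real n * t ^ Suc n * (\<integral>x. V x * h x ^ Suc n \<partial>M)"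
      using int intV by (subst Bochner_Integration.integral_add) (auto simp del: power_Suc)
    finally show "real (Suc n) * t ^ n * (\<integral>x. h x ^ n \<partial>P) \<le> C + real n * t ^ Suc n * (\<integral>x. h x ^ Suc n \<partial>Q)"
      unfolding A B using C by simp
  qed (use h C C0 in auto)
qed

text \<open>The inner bound is applied to the given test function at each starting point
  \<open>x\<close>. What remains is a function of \<open>x\<close> alone, to which the outer bound
  is applied as a new test function.\<close>

lemma moment_bound_bind:
  fixes C C' :: real
  assumes n: "0 < n" and C: "0 \<le> C" "0 \<le> C'"
    and P: "P \<in> space (prob_algebra M)" and Q: "Q \<in> space (prob_algebra M)"
    and K: "K \<in> M \<rightarrow>\<^sub>M prob_algebra N" and L: "L \<in> M \<rightarrow>\<^sub>M prob_algebra N"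
    and PQ: "moment_bound n C P Q"
    and KL: "\<And>x. x \<in> space M \<Longrightarrow> moment_bound n C' (K x) (L x)"
  shows "moment_bound n (C * C') (Giry_Monad.bind P K) (Giry_Monad.bind Q L)"
  unfolding moment_bound_def
proof (intro ballI allI impI)
  fix h :: "'b \<Rightarrow> real" and B
  assume h: "h \<in> borel_measurable (Giry_Monad.bind Q L)" and hB: "\<forall>x. 0 \<le> h x \<and> h x \<le> B"
  have h_meas [measurable]: "h \<in> borel_measurable N"
    using h sets_bind'[OF Q L] by (simp cong: measurable_cong_sets)
  have B: "0 \<le> B" using hB order_trans by blast
  have setsP: "sets P = sets M" and setsQ: "sets Q = sets M" using P Q by (auto simp: space_prob_algebra)
  have kernel: "K x \<in> space (prob_algebra N)" "L x \<in> space (prob_algebra N)" if "x \<in> space M" for x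
    using that measurable_space[OF K] measurable_space[OF L] by auto
  have int: "(\<integral>x. h x ^ k \<partial>Giry_Monad.bind R J) = (\<integral>x. \<integral>y. h y ^ k \<partial>J x \<partial>R)"
    if R: "R \<in> space (prob_algebra M)" and J: "J \<in> M \<rightarrow>\<^sub>M prob_algebra N" for R J k
  proof (rule integral_bind[where K = N and B = "B ^ k" and B' = 1])
    have sR: "sets R = sets M" and pR: "prob_space R" using R by (auto simp: space_prob_algebra)
    show "J \<in> R \<rightarrow>\<^sub>M subprob_algebra N"
      using measurable_prob_algebraD[OF J] sR by (simp cong: measurable_cong_sets)
    show "finite_measure R" using pR by (simp add: prob_space.finite_measure)
    show "AE x in R. emeasure (J x) (space (J x)) \<le> ennreal 1"
      using measurable_space[OF J] sets_eq_imp_space_eq[OF sR]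
      by (intro AE_I2) (auto simp: space_prob_algebra prob_space.emeasure_space_1)
    show "\<bar>h x ^ k\<bar> \<le> B ^ k" for x using hB by (auto intro: power_mono)
  qed measurable
  \<comment> \<open>The test function for the outer pair: its power \<open>Suc n\<close> is the
    inner moment under \<open>L x\<close>. On \<open>space M\<close> the root is at most
    \<open>B\<close>; the cap is for points outside, because \<open>moment_bound\<close> asks for a
    bound everywhere.\<close>
  define g where "g x = min B (root (Suc n) (\<integral>y. h y ^ Suc n \<partial>L x))" for x
  have g_root: "g x = root (Suc n) (\<integral>y. h y ^ Suc n \<partial>L x)" if "x \<in> space M" for x
  proof -
    interpret prob_space "L x" using kernel(2)[OF that] by (simp add: space_prob_algebra)
    have "(\<integral>y. h y ^ Suc n \<partial>L x) \<le> (\<integral>y. B ^ Suc n \<partial>L x)"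
      using hB by (intro integral_mono prob_integrable_bounded[OF kernel(2)[OF that] h_meas]) (auto intro: power_mono simp del: power_Suc)
    then have "root (Suc n) (\<integral>y. h y ^ Suc n \<partial>L x) \<le> root (Suc n) (B ^ Suc n)"
      by (simp add: prob_space del: power_Suc)
    then show ?thesis using B real_root_power_cancel[of "Suc n" B] by (simp add: g_def del: power_Suc)
  qed
  have g_pow: "g x ^ Suc n = (\<integral>y. h y ^ Suc n \<partial>L x)" if "x \<in> space M" for x
    unfolding g_root[OF that] using hB
    by (intro real_root_pow_pos2) (auto simp del: power_Suc)
  have g_bd: "0 \<le> g x \<and> g x \<le> B" for x
    unfolding g_def using B hB by (auto intro!: integral_nonneg_AE simp del: power_Suc)
  have meas: "(\<lambda>x. \<integral>y. h y ^ k \<partial>J x) \<in> borel_measurable M" if "J \<in> M \<rightarrow>\<^sub>M prob_algebra N" for J k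
    by (rule measurable_compose[OF measurable_prob_algebraD[OF that] integral_measurable_subprob_algebra]) measurable
  have g_meas [measurable]: "g \<in> borel_measurable M"
    unfolding g_def[abs_def] using meas[OF L, of "Suc n"] by measurable
  \<comment> \<open>Taking roots turns the bound for the kernels into one that is linear in
    \<open>g x ^ n\<close> and can be integrated over \<open>P\<close>.\<close>
  define c where "c = root (Suc n) C'"
  have c: "0 \<le> c" "c ^ Suc n = C'" using C by (auto simp: c_def real_root_pow_pos2 simp del: power_Suc)
  have le: "(\<integral>y. h y ^ n \<partial>K x) \<le> c * g x ^ n" if x: "x \<in> space M" for x
  proof (rule power_le_imp_le_base)
    have "(\<integral>y. h y ^ n \<partial>K x) ^ Suc n \<le> C' * (\<integral>y. h y ^ Suc n \<partial>L x) ^ n"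
      using kernel(2)[OF x] h_meas hB
      by (intro KL[OF x, unfolded moment_bound_def, rule_format, of h B])
        (auto simp: space_prob_algebra cong: measurable_cong_sets)
    also have "\<dots> = (c * g x ^ n) ^ Suc n"
      unfolding g_pow[OF x, symmetric] power_mult_distrib c(2) power_mult[symmetric] by (simp add: mult.commute)
    finally show "(\<integral>y. h y ^ n \<partial>K x) ^ Suc n \<le> (c * g x ^ n) ^ Suc n" .
    show "0 \<le> c * g x ^ n" using c g_bd by simp
  qed
  have u0: "0 \<le> (\<integral>y. h y ^ n \<partial>K x)" for x using hB by simp
  have intg: "integrable P (\<lambda>x. g x ^ n)"
    by (rule prob_integrable_bounded[OF P g_meas g_bd])
  have gP: "g \<in> borel_measurable Q" using setsQ g_meas by (simp cong: measurable_cong_sets)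
  have "(\<integral>x. \<integral>y. h y ^ n \<partial>K x \<partial>P) \<le> (\<integral>x. c * g x ^ n \<partial>P)"
  proof (rule integral_mono_AE)
    show cg: "integrable P (\<lambda>x. c * g x ^ n)" using intg by simp
    show ae: "AE x in P. (\<integral>y. h y ^ n \<partial>K x) \<le> c * g x ^ n"
      using le sets_eq_imp_space_eq[OF setsP] by (intro AE_I2) auto
    show "integrable P (\<lambda>x. \<integral>y. h y ^ n \<partial>K x)"
      by (rule Bochner_Integration.integrable_bound[OF cg])
        (use meas[OF K] setsP ae u0 in \<open>auto cong: measurable_cong_sets elim!: eventually_mono\<close>)
  qed
  also have "\<dots> = c * (\<integral>x. g x ^ n \<partial>P)" by simp
  finally have "(\<integral>x. h x ^ n \<partial>Giry_Monad.bind P K) \<le> c * (\<integral>x. g x ^ n \<partial>P)"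
    unfolding int[OF P K] .
  then have "(\<integral>x. h x ^ n \<partial>Giry_Monad.bind P K) ^ Suc n \<le> (c * (\<integral>x. g x ^ n \<partial>P)) ^ Suc n"
    using hB by (intro power_mono) (auto intro!: integral_nonneg_AE)
  also have "\<dots> = C' * (\<integral>x. g x ^ n \<partial>P) ^ Suc n" unfolding power_mult_distrib c(2) ..
  also have "\<dots> \<le> C' * (C * (\<integral>x. g x ^ Suc n \<partial>Q) ^ n)"
    using PQ gP g_bd C unfolding moment_bound_def by (intro mult_left_mono) (auto simp del: power_Suc)
  also have "(\<integral>x. g x ^ Suc n \<partial>Q) = (\<integral>x. \<integral>y. h y ^ Suc n \<partial>L x \<partial>Q)"
    using g_pow sets_eq_imp_space_eq[OF setsQ] by (intro Bochner_Integration.integral_cong) auto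
  also have "\<dots> = (\<integral>x. h x ^ Suc n \<partial>Giry_Monad.bind Q L)" unfolding int[OF Q L] ..
  finally show "(\<integral>x. h x ^ n \<partial>Giry_Monad.bind P K) ^ Suc n \<le>
      C * C' * (\<integral>x. h x ^ Suc n \<partial>Giry_Monad.bind Q L) ^ n" by (simp add: mult_ac)
qed

section \<open>Renyi divergence\<close>

lemma ereal_ln_mono: "x \<le> y \<Longrightarrow> ereal_ln x \<le> ereal_ln y"
  by (cases x; cases y) (auto simp: ereal_ln_def)

lemma ereal_ln_ereal [simp]: "0 < x \<Longrightarrow> ereal_ln (ereal x) = ereal (ln x)"
  by (simp add: ereal_ln_def)

lemma ereal_exp_ereal [simp]: "ereal_exp (ereal x) = ereal (exp x)"
  by (simp add: ereal_exp_def)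

lemma ereal_exp_nonneg: "0 \<le> ereal_exp x"
  by (cases x) (auto simp: ereal_exp_def)

lemma one_le_ereal_exp_iff: "1 \<le> ereal_exp x \<longleftrightarrow> 0 \<le> x"
  by (cases x) (auto simp: ereal_exp_def one_ereal_def)

lemma le_ereal_exp_of_ereal_ln_le:
  assumes "0 < c" "ereal (1 / c) * ereal_ln x \<le> y"
  shows "x \<le> ereal_exp (ereal c * y)"
proof (cases "x \<le> 0")
  case True
  then show ?thesis using ereal_exp_nonneg order_trans by blast
next
  case x: False
  show ?thesis
  proof (cases x)
    case (real r)
    with x have r: "r > 0" by simp
    show ?thesis
    proof (cases y)
      case (real s)
      have "ln r \<le> c * s" using assms r \<open>x = ereal r\<close> real by (simp add: field_simps)
      then have "exp (ln r) \<le> exp (c * s)" by simp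
      then show ?thesis using r \<open>x = ereal r\<close> real by simp
    qed (use assms r real in \<open>auto simp: ereal_exp_def\<close>)
  qed (use assms x in \<open>auto simp: ereal_ln_def ereal_exp_def\<close>)
qed

section \<open>Likelihood ratios as quotients of densities\<close>

lemma density_enn2real_RN_deriv:
  assumes P: "prob_space P" and Q: "prob_space Q" and sets: "sets P = sets Q"
    and ac: "absolutely_continuous Q P"
  shows "density Q (\<lambda>x. ennreal (enn2real (RN_deriv Q P x))) = P"
proof -
  interpret Q: prob_space Q by fact
  have "AE x in Q. RN_deriv Q P x \<noteq> \<infinity>"
    using P ac sets by (intro Q.RN_deriv_finite prob_space_imp_sigma_finite) auto
  then have "density Q (\<lambda>x. ennreal (enn2real (RN_deriv Q P x))) = density Q (RN_deriv Q P)"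
    by (intro density_cong) (auto simp: less_top)
  with Q.density_RN_deriv[OF ac sets] show ?thesis by simp
qed

text \<open>The zeros of \<open>y\<close> are a null set of \<open>Q\<close>, hence of
  \<open>P\<close>, so \<open>x\<close> vanishes there almost everywhere. The Radon-Nikodym
  derivative is determined only up to null sets of \<open>Q\<close>, so over \<open>M\<close> it can
  be identified only where \<open>y\<close> is positive.\<close>

lemma RN_deriv_density_ratio:
  fixes x y :: "'a \<Rightarrow> real"
  assumes [measurable]: "x \<in> borel_measurable M" "y \<in> borel_measurable M"
    and nonneg: "\<And>z. 0 \<le> x z" "\<And>z. 0 \<le> y z"
    and P: "P = density M x" "prob_space P" and Q: "Q = density M y" "prob_space Q"
    and ac: "absolutely_continuous Q P"
  shows "AE z in M. y z = 0 \<longrightarrow> x z = 0"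
    and "AE z in M. 0 < y z \<longrightarrow> enn2real (RN_deriv Q P z) = x z / y z"
proof -
  interpret Q: prob_space Q by fact
  let ?N = "{z \<in> space M. y z = 0}"
  have "emeasure Q ?N = 0"
    unfolding Q(1) using nonneg by (subst emeasure_density) (auto simp: nn_integral_0_iff_AE indicator_def)
  then have "?N \<in> null_sets Q" by (simp add: null_sets_def Q(1))
  then have "emeasure P ?N = 0"
    using ac by (auto simp: absolutely_continuous_def)
  then have "(\<integral>\<^sup>+ z. ennreal (x z) * indicator ?N z \<partial>M) = 0"
    unfolding P(1) by (subst (asm) emeasure_density) auto
  then have "AE z in M. ennreal (x z) * indicator ?N z = 0"
    by (subst (asm) nn_integral_0_iff_AE) auto
  then show null: "AE z in M. y z = 0 \<longrightarrow> x z = 0"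
    using AE_space by eventually_elim (use nonneg in \<open>auto simp: indicator_def split: if_splits\<close>)
  have "density Q (\<lambda>z. ennreal (x z / y z)) = density M (\<lambda>z. ennreal (y z) * ennreal (x z / y z))"
    unfolding Q(1) by (subst density_density_eq) auto
  also have "\<dots> = P" unfolding P(1)
    using null by (intro density_cong) (auto simp: ennreal_mult'[symmetric] nonneg)
  finally have "AE z in Q. ennreal (x z / y z) = RN_deriv Q P z"
    by (intro Q.RN_deriv_unique) (simp_all add: Q(1))
  then have "AE z in M. 0 < ennreal (y z) \<longrightarrow> ennreal (x z / y z) = RN_deriv Q P z"
    unfolding Q(1) by (subst (asm) AE_density) auto
  then show "AE z in M. 0 < y z \<longrightarrow> enn2real (RN_deriv Q P z) = x z / y z"
  proof eventually_elim
    case (elim z)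
    then show ?case using nonneg[of z] by (metis enn2real_ennreal divide_nonneg_nonneg ennreal_less_zero_iff)
  qed
qed

text \<open>Indicators as test functions give absolute continuity. The likelihood ratio itself is
  the equality case of Hoelder's inequality; its truncations \<open>h k\<close> are admissible and
  satisfy \<open>h k ^ Suc n \<le> l * h k ^ n\<close>, so with \<open>?A\<close> the integral of
  \<open>h k ^ n\<close> under \<open>P\<close> the bound reads
  \<open>?A ^ Suc n \<le> C * ?A ^ n\<close>. Cancelling gives \<open>?A \<le> C\<close>, and
  monotone convergence removes the truncation.\<close>

lemma moment_boundD:
  assumes n: "0 < n" and C: "0 \<le> C"
    and P: "prob_space P" and Q: "prob_space Q" and sets: "sets P = sets Q"
    and bound: "moment_bound n C P Q"
  shows "absolutely_continuous Q P"
    and "(\<integral>\<^sup>+x. ennreal (enn2real (RN_deriv Q P x) ^ n) \<partial>P) \<le> ennreal C"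
proof -
  interpret P: prob_space P by fact
  interpret Q: prob_space Q by fact
  have Palg: "P \<in> space (prob_algebra Q)" and Qalg: "Q \<in> space (prob_algebra Q)"
    using P Q sets by (auto simp: space_prob_algebra)
  show ac: "absolutely_continuous Q P"
    unfolding absolutely_continuous_def
  proof
    fix N assume N: "N \<in> null_sets Q"
    then have N': "N \<in> sets Q" "measure Q N = 0" by (auto simp: measure_def)
    have ind: "indicator N x ^ k = (indicator N x :: real)" if "0 < k" for k x
      using that by (auto simp: indicator_def)
    have "(\<integral>x. indicator N x ^ n \<partial>P) ^ Suc n \<le> C * (\<integral>x. indicator N x ^ Suc n \<partial>Q) ^ n"
      using bound[unfolded moment_bound_def, rule_format, of "indicator N" 1] N'(1)
      by (auto simp: indicator_def)
    then have "measure P N ^ Suc n \<le> C * measure Q N ^ n"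
      using n N'(1) sets by (simp only: ind zero_less_Suc) simp
    then have "measure P N ^ Suc n \<le> 0" using N' n by (simp add: power_0_left)
    moreover have "0 \<le> measure P N ^ Suc n" by simp
    ultimately have "measure P N ^ Suc n = 0" by linarith
    then have "measure P N = 0" by auto
    then show "N \<in> null_sets P" using N' sets by (simp add: null_sets_def P.emeasure_eq_measure)
  qed
  define l where "l x = enn2real (RN_deriv Q P x)" for x
  have l_meas [measurable]: "l \<in> borel_measurable Q" unfolding l_def[abs_def] by measurable
  have l0: "0 \<le> l x" for x by (simp add: l_def)
  have PQ: "P = density Q l"
    using density_enn2real_RN_deriv[OF P Q sets ac] unfolding l_def by simp
  define h where "h k x = min (l x) (real k)" for k x
  have h_meas [measurable]: "h k \<in> borel_measurable Q" for k unfolding h_def[abs_def] by measurable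
  have h: "0 \<le> h k x \<and> h k x \<le> real k" for k x using l0 by (auto simp: h_def)
  have I: "(\<integral>x. h k x ^ n \<partial>P) \<le> C" for k
  proof -
    have intP: "integrable P (\<lambda>x. h k x ^ n)" and intQ: "integrable Q (\<lambda>x. h k x ^ Suc n)"
      using prob_integrable_bounded[OF Palg h_meas h] prob_integrable_bounded[OF Qalg h_meas h] by (auto simp del: power_Suc)
    let ?A = "\<integral>x. h k x ^ n \<partial>P" and ?B = "\<integral>x. h k x ^ Suc n \<partial>Q"
    have "?B \<le> (\<integral>x. l x * h k x ^ n \<partial>Q)"
    proof (rule integral_mono[OF intQ])
      show "integrable Q (\<lambda>x. l x * h k x ^ n)"
        using intP l0 by (simp add: PQ integrable_density)
      show "h k x ^ Suc n \<le> l x * h k x ^ n" for x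
        using h[of k x] by (auto simp: h_def intro: mult_right_mono)
    qed
    also have "\<dots> = ?A" using l0 by (simp add: PQ integral_density)
    finally have BA: "?B \<le> ?A" .
    have B0: "0 \<le> ?B" using h by (intro integral_nonneg_AE AE_I2) (auto simp del: power_Suc)
    have "?A ^ Suc n \<le> C * ?B ^ n"
      using bound[unfolded moment_bound_def, rule_format, of "h k" "real k"] h by auto
    also have "\<dots> \<le> C * ?A ^ n"
      using BA B0 C by (intro mult_left_mono power_mono) auto
    finally have "?A * ?A ^ n \<le> C * ?A ^ n" by simp
    then show ?thesis
      using BA B0 C by (cases "?A = 0") (auto simp: mult_le_cancel_right)
  qed
  have "(\<lambda>k. \<integral>\<^sup>+x. ennreal (h k x ^ n) \<partial>P) \<longlonglongrightarrow> (\<integral>\<^sup>+x. ennreal (l x ^ n) \<partial>P)"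
  proof (rule nn_integral_LIMSEQ)
    show "incseq (\<lambda>k x. ennreal (h k x ^ n))"
      using h by (auto simp: incseq_def le_fun_def h_def intro!: ennreal_leI power_mono)
    show "(\<lambda>x. ennreal (h k x ^ n)) \<in> borel_measurable P" for k
      using sets by (simp cong: measurable_cong_sets)
    show "(\<lambda>k. ennreal (h k x ^ n)) \<longlonglongrightarrow> ennreal (l x ^ n)" for x
    proof (rule tendsto_eventually)
      obtain k0 where "l x \<le> real k0" using real_arch_simple by blast
      then show "\<forall>\<^sub>F k in sequentially. ennreal (h k x ^ n) = ennreal (l x ^ n)"
        unfolding eventually_sequentially by (intro exI[of _ k0]) (auto simp: h_def min_def)
    qed
  qed
  moreover have "(\<integral>\<^sup>+x. ennreal (h k x ^ n) \<partial>P) \<le> ennreal C" for k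
    using I[of k] h prob_integrable_bounded[OF Palg h_meas h, of k n]
    by (subst nn_integral_eq_integral) (auto intro: ennreal_leI)
  ultimately show "(\<integral>\<^sup>+x. ennreal (enn2real (RN_deriv Q P x) ^ n) \<partial>P) \<le> ennreal C"
    unfolding l_def[symmetric] by (intro LIMSEQ_le_const2) auto
qed

lemma renyi_finite_le_of_moment_bound:
  assumes n: "0 < n" and C: "0 < C"
    and "prob_space P" "prob_space Q" "sets P = sets Q" "moment_bound n C P Q"
  shows "renyi_finite (real (Suc n)) P Q \<le> ereal (ln C / real n)"
proof -
  have eq: "x powr real n = x ^ n" if "0 \<le> x" for x :: real
    using that n by (cases "x = 0") (auto simp: powr_realpow)
  have "enn2ereal (\<integral>\<^sup>+x. ennreal (enn2real (RN_deriv Q P x) ^ n) \<partial>P) \<le> ereal C"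
    using moment_boundD(2)[OF n less_imp_le[OF C] assms(3-6)] C
    by (metis enn2ereal_ennreal less_eq_ennreal.rep_eq less_imp_le)
  then have "ereal_ln (enn2ereal (\<integral>\<^sup>+x. ennreal (enn2real (RN_deriv Q P x) ^ n) \<partial>P)) \<le> ereal (ln C)"
    using ereal_ln_mono[of _ "ereal C"] C by simp
  then have "ereal (1 / real n) * ereal_ln (enn2ereal (\<integral>\<^sup>+x. ennreal (enn2real (RN_deriv Q P x) ^ n) \<partial>P))
      \<le> ereal (1 / real n) * ereal (ln C)"
    by (intro ereal_mult_left_mono) auto
  then show ?thesis
    using moment_boundD(1)[OF n less_imp_le[OF C] assms(3-6)] unfolding renyi_finite_def
    by (simp add: eq)
qed

section \<open>Monotonicity in the order and the limit order\<close>

lemma powr_le_tangent: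
  fixes y \<theta> :: real
  assumes "0 \<le> y" "0 < \<theta>" "\<theta> \<le> 1"
  shows "y powr \<theta> \<le> 1 - \<theta> + \<theta> * y"
proof (cases "y = 0")
  case False
  then show ?thesis
    using Youngs_inequality_0[of \<theta> "1 - \<theta>" y 1] assms by simp
qed (use assms in auto)

text \<open>The exponential of the divergence of order \<open>a\<close> is the power mean of the
  likelihood ratio under \<open>P\<close> with exponent \<open>a - 1\<close>, and power means
  increase with the exponent.\<close>

lemma renyi_finite_mono:
  assumes P: "prob_space P" and Q: "prob_space Q" and sets: "sets P = sets Q"
    and ab: "1 < a" "a \<le> b"
  shows "renyi_finite a P Q \<le> renyi_finite b P Q"
proof (cases "absolutely_continuous Q P")
  case ac: True
  interpret P: prob_space P by fact
  define l where "l x = enn2real (RN_deriv Q P x)" for x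
  have "l \<in> borel_measurable Q" unfolding l_def[abs_def] by measurable
  then have l_meas [measurable]: "l \<in> borel_measurable P" using sets by (simp cong: measurable_cong_sets)
  have l0: "0 \<le> l x" for x by (simp add: l_def)
  have dens: "density Q (\<lambda>x. ennreal (l x)) = P"
    unfolding l_def by (rule density_enn2real_RN_deriv[OF P Q sets ac])
  have "AE x in density Q (\<lambda>x. ennreal (l x)). 0 < l x"
    using \<open>l \<in> borel_measurable Q\<close> by (subst AE_density) auto
  then have pos: "AE x in P. 0 < l x" unfolding dens .
  define s t where "s = a - 1" and "t = b - 1"
  have st: "0 < s" "s \<le> t" using ab by (auto simp: s_def t_def)
  let ?Y = "\<integral>\<^sup>+x. ennreal (l x powr s) \<partial>P" and ?X = "\<integral>\<^sup>+x. ennreal (l x powr t) \<partial>P"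
  have "ereal (1 / s) * ereal_ln (enn2ereal ?Y) \<le> ereal (1 / t) * ereal_ln (enn2ereal ?X)"
  proof (cases ?X)
    case (real X)
    have "?X \<noteq> 0"
    proof
      assume "?X = 0"
      then have "AE x in P. ennreal (l x powr t) = 0" by (subst (asm) nn_integral_0_iff_AE) auto
      with pos have "AE x in P. False" by eventually_elim auto
      then show False by simp
    qed
    with real have X: "0 < X" by (cases "X = 0") auto
    \<comment> \<open>Jensen's bound for \<open>?Y\<close>. Dividing \<open>l x powr t\<close> by
      \<open>X\<close> normalizes its mean to 1, so the tangent of the concave power at 1 integrates
      to exactly \<open>m\<close>.\<close>
    define m where "m = X powr (s / t)"
    have m: "0 < m" using X by (simp add: m_def)
    have "?Y \<le> (\<integral>\<^sup>+x. ennreal (m * (1 - s / t)) + ennreal (m * (s / t) / X) * ennreal (l x powr t) \<partial>P)"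
    proof (rule nn_integral_mono)
      fix x
      have "(l x powr t / X) powr (s / t) \<le> 1 - s / t + (s / t) * (l x powr t / X)"
        using st X by (intro powr_le_tangent) auto
      moreover have "(l x powr t / X) powr (s / t) = l x powr s / m"
        using st X by (simp add: powr_divide powr_powr m_def)
      ultimately have "l x powr s \<le> m * (1 - s / t + (s / t) * (l x powr t / X))"
        using m by (simp add: divide_le_eq mult.commute)
      also have "\<dots> = m * (1 - s / t) + m * (s / t) / X * l x powr t"
        by (simp add: distrib_left)
      finally have "l x powr s \<le> m * (1 - s / t) + m * (s / t) / X * l x powr t" .
      then have "ennreal (l x powr s) \<le> ennreal (m * (1 - s / t) + m * (s / t) / X * l x powr t)"
        by (rule ennreal_leI)
      also have "\<dots> = ennreal (m * (1 - s / t)) + ennreal (m * (s / t) / X * l x powr t)"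
        using m X st by (intro ennreal_plus) auto
      also have "ennreal (m * (s / t) / X * l x powr t) = ennreal (m * (s / t) / X) * ennreal (l x powr t)"
        using m X st by (intro ennreal_mult) auto
      finally show "ennreal (l x powr s) \<le> ennreal (m * (1 - s / t)) + ennreal (m * (s / t) / X) * ennreal (l x powr t)" .
    qed
    also have "\<dots> = ennreal (m * (1 - s / t)) + ennreal (m * (s / t) / X) * ennreal X"
      by (simp add: nn_integral_add nn_integral_cmult P.emeasure_space_1 real)
    also have "\<dots> = ennreal (m * (1 - s / t) + m * (s / t) / X * X)"
      using m X st by (subst ennreal_mult[symmetric], simp, simp, subst ennreal_plus[symmetric]) auto
    also have "m * (1 - s / t) + m * (s / t) / X * X = m" using X by (simp add: algebra_simps)
    finally have "enn2ereal ?Y \<le> ereal m"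
      using m by (metis enn2ereal_ennreal less_eq_ennreal.rep_eq less_imp_le)
    then have "ereal_ln (enn2ereal ?Y) \<le> ereal (ln m)"
      using ereal_ln_mono m by fastforce
    then have "ereal (1 / s) * ereal_ln (enn2ereal ?Y) \<le> ereal (1 / s) * ereal (ln m)"
      using st by (intro ereal_mult_left_mono) auto
    also have "\<dots> = ereal (1 / t) * ereal (ln X)" using X st by (simp add: m_def ln_powr)
    finally show ?thesis using real X by simp
  qed (use st in \<open>simp add: ereal_ln_def\<close>)
  then show ?thesis using ac by (simp add: renyi_finite_def l_def s_def t_def)
qed (simp add: renyi_finite_def)

text \<open>By monotonicity the limit over the orders exists and is their supremum; only then does
  \<open>Lim\<close> have a known value.\<close>

lemma renyi_finite_le_renyi_infinity:
  assumes "prob_space P" "prob_space Q" "sets P = sets Q" and a: "1 < a"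
  shows "renyi_finite a P Q \<le> renyi_divergence \<infinity> P Q"
proof -
  note mono = renyi_finite_mono[OF assms(1-3)]
  have "((\<lambda>a. renyi_finite a P Q) \<longlongrightarrow> (SUP a\<in>{1<..}. renyi_finite a P Q)) at_top"
  proof (rule order_tendstoI)
    fix y assume "y < (SUP a\<in>{1<..}. renyi_finite a P Q)"
    then obtain b where b: "1 < b" "y < renyi_finite b P Q" by (auto simp: less_SUP_iff)
    show "\<forall>\<^sub>F a in at_top. y < renyi_finite a P Q"
      using eventually_ge_at_top[of b]
      by eventually_elim (rule less_le_trans[OF b(2) mono[OF b(1)]])
  next
    fix y assume y: "(SUP a\<in>{1<..}. renyi_finite a P Q) < y"
    show "\<forall>\<^sub>F a in at_top. renyi_finite a P Q < y"
      using eventually_gt_at_top[of 1]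
    proof eventually_elim
      case (elim a)
      then have "renyi_finite a P Q \<le> (SUP a\<in>{1<..}. renyi_finite a P Q)" by (intro SUP_upper) simp
      then show ?case using y by (rule le_less_trans)
    qed
  qed
  then have "renyi_divergence \<infinity> P Q = (SUP a\<in>{1<..}. renyi_finite a P Q)"
    by (simp add: renyi_divergence_def tendsto_Lim)
  then show ?thesis using a by (simp only:) (intro SUP_upper, simp)
qed

lemma renyi_finite_moment_le:
  assumes "1 < a" "absolutely_continuous Q P" "renyi_finite a P Q \<le> \<epsilon>"
  shows "enn2ereal (\<integral>\<^sup>+x. ennreal (enn2real (RN_deriv Q P x) powr (a - 1)) \<partial>P) \<le> ereal_exp (ereal (a - 1) * \<epsilon>)"
  using assms by (intro le_ereal_exp_of_ereal_ln_le) (auto simp: renyi_finite_def)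

text \<open>Markov's inequality for the \<open>n\<close>-th power gives the set where
  \<open>l\<close> is at least \<open>K * c\<close> mass at most \<open>(1 / c) ^ n\<close>, for
  every \<open>n\<close>, so it is null as soon as \<open>c > 1\<close>. Countably many such
  \<open>c\<close> tending to 1 suffice.\<close>

lemma AE_le_of_moments_le:
  assumes "prob_space P" and [measurable]: "l \<in> borel_measurable P" and K: "0 < K"
    and moments: "\<And>n. (\<integral>\<^sup>+x. ennreal (l x ^ n) \<partial>P) \<le> ennreal (K ^ n)"
  shows "AE x in P. l x \<le> (K :: real)"
proof -
  interpret prob_space P by fact
  have small: "AE x in P. l x < K * (1 + 1 / real (Suc k))" for k
  proof -
    define c where "c = 1 + 1 / real (Suc k)"
    have c: "1 < c" by (simp add: c_def)
    let ?E = "{x \<in> space P. K * c \<le> l x}"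
    have "measure P ?E \<le> (1 / c) ^ n" for n
    proof -
      have "ennreal ((K * c) ^ n * measure P ?E) = (\<integral>\<^sup>+x. ennreal ((K * c) ^ n) * indicator ?E x \<partial>P)"
        using K c by (simp add: nn_integral_cmult_indicator emeasure_eq_measure ennreal_mult)
      also have "\<dots> \<le> (\<integral>\<^sup>+x. ennreal (l x ^ n) \<partial>P)"
        using K c by (intro nn_integral_mono) (auto simp: indicator_def intro!: ennreal_leI power_mono)
      also have "\<dots> \<le> ennreal (K ^ n)" by fact
      finally have "(K * c) ^ n * measure P ?E \<le> K ^ n" using K by (simp add: ennreal_le_iff)
      then have "c ^ n * measure P ?E \<le> 1" using K by (simp add: power_mult_distrib mult.assoc)
      then show ?thesis using c by (simp add: power_divide le_divide_eq mult.commute)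
    qed
    moreover have "(\<lambda>n. (1 / c) ^ n) \<longlonglongrightarrow> 0" using c by (intro LIMSEQ_power_zero) auto
    ultimately have "measure P ?E \<le> 0" by (intro LIMSEQ_le_const) auto
    then have "emeasure P ?E = 0" by (simp add: emeasure_eq_measure measure_le_0_iff)
    then show ?thesis by (intro AE_I[of _ _ ?E]) (auto simp: c_def not_less)
  qed
  then have "AE x in P. \<forall>k. l x < K * (1 + 1 / real (Suc k))" by (simp add: AE_all_countable)
  then show ?thesis
  proof eventually_elim
    case (elim x)
    have "(\<lambda>k. K * (1 + 1 / real (Suc k))) \<longlonglongrightarrow> K * (1 + 0)"
      by (intro tendsto_intros LIMSEQ_Suc lim_1_over_n)
    then show ?case using elim by (intro LIMSEQ_le_const[where x = K]) (auto intro: less_imp_le)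
  qed
qed

section \<open>Moments of adjacent pairs\<close>

text \<open>The factor that accompanies \<open>q ^ j\<close> and the binomial coefficient in the
  claimed bound, for \<open>e\<close> the sum of the two parameter functions. The extra alternative
  at \<open>j = 2\<close> is built in so that one sum can run from 2.\<close>

definition moment_term :: "(ereal \<Rightarrow> ereal) \<Rightarrow> nat \<Rightarrow> ereal" where
  "moment_term e j =
    (let b = ereal_exp (ereal (real j - 1) * e (ereal (real j))) * min 2 ((ereal_exp (e \<infinity>) - 1) ^ j)
     in if j = 2 then min (4 * (ereal_exp (e 2) - 1)) b else b)"

lemma ereal_mult_min_distrib:
  fixes c :: ereal
  shows "x \<le> c * a \<Longrightarrow> x \<le> c * b \<Longrightarrow> x \<le> c * min a b"
  by (simp add: min_def)

lemma infinity_ereal_power: "0 < n \<Longrightarrow> (\<infinity> :: ereal) ^ n = \<infinity>"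
proof (induction n)
  case (Suc n)
  then show ?case by (cases n) auto
qed simp

text \<open>The situation without absolute continuity, where the divergences of all orders are
  infinite and so are their bounds. The cap 2 does not help, because it multiplies an infinite
  exponential.\<close>

lemma moment_term_eq_infinity:
  assumes "2 \<le> j" and "e (ereal (real j)) = \<infinity>" "e 2 = \<infinity>" "e \<infinity> = \<infinity>"
  shows "moment_term e j = \<infinity>"
proof -
  have "(\<infinity> :: ereal) ^ j = \<infinity>" using assms by (simp add: infinity_ereal_power)
  moreover have "ereal (real j - 1) * \<infinity> = \<infinity>" using assms by simp
  ultimately show ?thesis using assms by (simp add: moment_term_def ereal_exp_def Let_def)
qed

text \<open>Densities with respect to a common measure, rather than \<open>RN_deriv Q P\<close>,
  allow the laws of all samples to be compared and averaged pointwise.\<close>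

locale density_pair =
  fixes M :: "'a measure" and P Q and x y :: "'a \<Rightarrow> real"
  assumes x_meas [measurable]: "x \<in> borel_measurable M" and y_meas [measurable]: "y \<in> borel_measurable M"
    and x_nonneg: "0 \<le> x z" and y_nonneg: "0 \<le> y z"
    and P_def: "P = density M x" and prob_P: "prob_space P"
    and Q_def: "Q = density M y" and prob_Q: "prob_space Q"
begin

lemma sets_eq: "sets P = sets Q"
  by (simp add: P_def Q_def)

lemma nn_integral_x: "(\<integral>\<^sup>+z. ennreal (x z) \<partial>M) = 1"
  using prob_space.emeasure_space_1[OF prob_P] by (simp add: P_def emeasure_density cong: nn_integral_cong)

lemma nn_integral_y: "(\<integral>\<^sup>+z. ennreal (y z) \<partial>M) = 1"
  using prob_space.emeasure_space_1[OF prob_Q] by (simp add: Q_def emeasure_density cong: nn_integral_cong)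

lemma nn_integral_RN_deriv_power:
  assumes ac: "absolutely_continuous Q P" and j: "0 < j"
  shows "(\<integral>\<^sup>+z. ennreal (enn2real (RN_deriv Q P z) powr real j) \<partial>P) = (\<integral>\<^sup>+z. ennreal (x z ^ Suc j / y z ^ j) \<partial>M)"
proof -
  have eq: "u powr real j = u ^ j" if "0 \<le> u" for u :: real
    using that j by (cases "u = 0") (auto simp: powr_realpow)
  have [measurable]: "RN_deriv Q P \<in> borel_measurable M"
    using borel_measurable_RN_deriv[of Q P] by (simp add: Q_def)
  have "(\<integral>\<^sup>+z. ennreal (enn2real (RN_deriv Q P z) powr real j) \<partial>P) =
      (\<integral>\<^sup>+z. ennreal (x z) * ennreal (enn2real (RN_deriv Q P z) ^ j) \<partial>M)"
    by (subst P_def, subst nn_integral_density) (auto simp: eq)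
  also have "\<dots> = (\<integral>\<^sup>+z. ennreal (x z ^ Suc j / y z ^ j) \<partial>M)"
  proof (rule nn_integral_cong_AE)
    show "AE z in M. ennreal (x z) * ennreal (enn2real (RN_deriv Q P z) ^ j) = ennreal (x z ^ Suc j / y z ^ j)"
      using RN_deriv_density_ratio[OF x_meas y_meas x_nonneg y_nonneg P_def prob_P Q_def prob_Q ac]
    proof eventually_elim
      case (elim z)
      then show ?case using x_nonneg[of z] y_nonneg[of z]
        by (cases "y z = 0") (auto simp: ennreal_mult[symmetric] power_divide)
    qed
  qed
  finally show ?thesis .
qed

lemma moment_le_of_renyi:
  assumes "absolutely_continuous Q P" "0 < j" "renyi_finite (real (Suc j)) P Q \<le> \<epsilon>"
  shows "enn2ereal (\<integral>\<^sup>+z. ennreal (x z ^ Suc j / y z ^ j) \<partial>M) \<le> ereal_exp (ereal (real j) * \<epsilon>)"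
  using renyi_finite_moment_le[of "real (Suc j)" Q P \<epsilon>] assms nn_integral_RN_deriv_power[OF assms(1,2)] by simp

text \<open>Dividing the tangent inequality at \<open>y z\<close> by \<open>y z ^ j\<close> and
  integrating leaves \<open>Suc j \<le> ?X + j\<close>. This is nonnegativity of the divergence; it
  is what lets an additive 1 be absorbed into the factor 2 later.\<close>

lemma one_le_moment:
  assumes ac: "absolutely_continuous Q P"
  shows "1 \<le> (\<integral>\<^sup>+z. ennreal (x z ^ Suc j / y z ^ j) \<partial>M)"
proof -
  let ?X = "\<integral>\<^sup>+z. ennreal (x z ^ Suc j / y z ^ j) \<partial>M"
  have "(\<integral>\<^sup>+z. ennreal (real (Suc j)) * ennreal (x z) \<partial>M) \<le>
      (\<integral>\<^sup>+z. ennreal (x z ^ Suc j / y z ^ j) + ennreal (real j) * ennreal (y z) \<partial>M)"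
  proof (rule nn_integral_mono_AE)
    show "AE z in M. ennreal (real (Suc j)) * ennreal (x z) \<le>
        ennreal (x z ^ Suc j / y z ^ j) + ennreal (real j) * ennreal (y z)"
      using RN_deriv_density_ratio(1)[OF x_meas y_meas x_nonneg y_nonneg P_def prob_P Q_def prob_Q ac]
    proof eventually_elim
      case (elim z)
      have "real (Suc j) * x z \<le> x z ^ Suc j / y z ^ j + real j * y z"
      proof (cases "y z = 0")
        case False
        then have y: "0 < y z" using y_nonneg[of z] by simp
        have "real (Suc j) * y z ^ j * x z / y z ^ j \<le> (x z ^ Suc j + real j * y z ^ Suc j) / y z ^ j"
          using y power_tangent[OF x_nonneg y_nonneg, of j z z] by (intro divide_right_mono) auto
        then show ?thesis using y by (simp add: add_divide_distrib del: of_nat_Suc)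
      qed (use elim in auto)
      then have "ennreal (real (Suc j) * x z) \<le> ennreal (x z ^ Suc j / y z ^ j + real j * y z)"
        by (rule ennreal_leI)
      then show ?case using x_nonneg[of z] y_nonneg[of z]
        by (simp add: ennreal_mult ennreal_plus del: of_nat_Suc power_Suc)
    qed
  qed
  then have "ennreal (real (Suc j)) \<le> ?X + ennreal (real j)"
    by (simp add: nn_integral_add nn_integral_cmult nn_integral_x nn_integral_y del: of_nat_Suc power_Suc)
  also have "ennreal (real (Suc j)) = 1 + ennreal (real j)" by (simp add: ennreal_plus)
  finally show ?thesis by (metis ennreal_add_left_cancel_le ennreal_neq_top add.commute infinity_ennreal_def)
qed

text \<open>Order \<infinity> dominates every finite order, so the \<open>n\<close>-th moment of the
  likelihood ratio is at most \<open>K ^ n\<close> for all \<open>n\<close> with \<open>K\<close>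
  the exponential of \<epsilon>; this bounds the ratio itself.\<close>

lemma density_le_of_renyi:
  assumes ac: "absolutely_continuous Q P"
    and renyi: "renyi_divergence \<infinity> P Q \<le> \<epsilon>" and fin: "\<epsilon> \<noteq> \<infinity>"
  obtains K where "\<epsilon> = ereal (ln K)" "1 \<le> K" "AE z in M. x z \<le> K * y z"
proof -
  note RN = RN_deriv_density_ratio[OF x_meas y_meas x_nonneg y_nonneg P_def prob_P Q_def prob_Q ac]
  have renyi': "renyi_finite a P Q \<le> \<epsilon>" if "1 < a" for a
    using renyi_finite_le_renyi_infinity[OF prob_P prob_Q sets_eq that] renyi by (rule order_trans)
  \<comment> \<open>The second moment is at least 1, which excludes negative \<epsilon>, including
    \<open>-\<infinity>\<close>.\<close>
  have "1 \<le> enn2ereal (\<integral>\<^sup>+z. ennreal (x z ^ Suc 1 / y z ^ 1) \<partial>M)"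
    using one_le_moment[OF ac, of 1] by (metis less_eq_ennreal.rep_eq one_ennreal.rep_eq)
  also have "\<dots> \<le> ereal_exp (ereal (real 1) * \<epsilon>)"
    using renyi' by (intro moment_le_of_renyi[OF ac]) auto
  finally have \<epsilon>0: "0 \<le> \<epsilon>" by (simp add: one_le_ereal_exp_iff)
  with fin obtain r where r: "\<epsilon> = ereal r" by (cases \<epsilon>) auto
  define K where "K = exp r"
  let ?l = "\<lambda>z. enn2real (RN_deriv Q P z)"
  have "AE z in P. ?l z \<le> K"
  proof (rule AE_le_of_moments_le[OF prob_P])
    show "?l \<in> borel_measurable P"
      using borel_measurable_RN_deriv[of Q P] by (simp add: measurable_cong_sets[OF sets_eq refl])
    fix n
    show "(\<integral>\<^sup>+z. ennreal (?l z ^ n) \<partial>P) \<le> ennreal (K ^ n)"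
    proof (cases "n = 0")
      case True
      then show ?thesis using prob_space.emeasure_space_1[OF prob_P] by simp
    next
      case False
      have eq: "u powr real n = u ^ n" if "0 \<le> u" for u :: real
        using that False by (cases "u = 0") (auto simp: powr_realpow)
      have "enn2ereal (\<integral>\<^sup>+z. ennreal (?l z powr (real (Suc n) - 1)) \<partial>P) \<le> ereal_exp (ereal (real (Suc n) - 1) * \<epsilon>)"
        using renyi' ac False by (intro renyi_finite_moment_le) auto
      then have "enn2ereal (\<integral>\<^sup>+z. ennreal (?l z ^ n) \<partial>P) \<le> ereal (K ^ n)"
        by (simp add: eq r K_def exp_of_nat_mult)
      then show ?thesis by (simp add: less_eq_ennreal.rep_eq K_def)
    qed
  qed (simp add: K_def)
  then have "AE z in M. 0 < x z \<longrightarrow> ?l z \<le> K" unfolding P_def by (subst (asm) AE_density) auto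
  with RN have "AE z in M. x z \<le> K * y z"
  proof eventually_elim
    case (elim z)
    then show ?case using x_nonneg[of z] y_nonneg[of z]
      by (cases "x z = 0"; cases "y z = 0") (auto simp: K_def divide_le_eq)
  qed
  moreover have "\<epsilon> = ereal (ln K)" "1 \<le> K" using r \<epsilon>0 by (auto simp: K_def)
  ultimately show ?thesis using that by blast
qed

end

text \<open>Each part of \<open>moment_term\<close> is one estimate of the same integral. The cap 2
  comes from bounding the power of the difference by the sum of the powers and using that the
  exponential is at least 1. The power of \<open>ereal_exp (e \<infinity>) - 1\<close> comes from
  the pointwise ratio bounds in both directions. At \<open>j = 2\<close> the integral is the
  chi-squared divergence, which has a closed form.\<close>

lemma moment_term_bound:
  fixes e :: "ereal \<Rightarrow> ereal"
  assumes dp: "density_pair M P Q x y"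
    and PQ: "\<And>a. 1 < a \<Longrightarrow> renyi_divergence a P Q \<le> e a"
    and QP: "\<And>a. 1 < a \<Longrightarrow> renyi_divergence a Q P \<le> e a"
    and j: "2 \<le> j"
  shows "enn2ereal (\<integral>\<^sup>+z. ennreal (\<bar>x z - y z\<bar> ^ j / y z ^ (j - 1)) \<partial>M) \<le> moment_term e j" (is "enn2ereal ?I \<le> _")
    and "moment_term e j \<noteq> \<infinity> \<Longrightarrow> AE z in M. y z = 0 \<longrightarrow> x z = 0"
proof -
  interpret density_pair M P Q x y by fact
  interpret swap: density_pair M Q P y x
    by (intro density_pair.intro x_meas y_meas x_nonneg y_nonneg P_def prob_P Q_def prob_Q)
  let ?e = "e (ereal (real j))"
  have fin: "renyi_finite a P Q \<le> e (ereal a)" "renyi_finite a Q P \<le> e (ereal a)" if "1 < a" for a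
    using PQ[of "ereal a"] QP[of "ereal a"] that by (auto simp: renyi_divergence_def one_ereal_def)
  have inf: "renyi_divergence \<infinity> P Q \<le> e \<infinity>" "renyi_divergence \<infinity> Q P \<le> e \<infinity>"
    using PQ[of \<infinity>] QP[of \<infinity>] by auto
  have fin2: "renyi_finite 2 P Q \<le> e \<infinity>" "renyi_finite 2 Q P \<le> e \<infinity>"
    using inf renyi_finite_le_renyi_infinity[OF prob_P prob_Q sets_eq, of 2]
      renyi_finite_le_renyi_infinity[OF prob_Q prob_P sets_eq[symmetric], of 2] by auto
  \<comment> \<open>Order \<infinity> is covered through order 2, whose divergence is already
    infinite without absolute continuity.\<close>
  have cases: "(?e = \<infinity> \<and> e 2 = \<infinity> \<and> e \<infinity> = \<infinity>) \<or> absolutely_continuous Q P"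
    using fin(1)[of "real j"] fin(1)[of 2] fin2(1) j by (auto simp: renyi_finite_def split: if_splits)
  have cases': "(?e = \<infinity> \<and> e 2 = \<infinity> \<and> e \<infinity> = \<infinity>) \<or> absolutely_continuous P Q"
    using fin(2)[of "real j"] fin(2)[of 2] fin2(2) j by (auto simp: renyi_finite_def split: if_splits)
  note all_inf = moment_term_eq_infinity[of j e, OF j]
  show "enn2ereal ?I \<le> moment_term e j"
  proof (cases "absolutely_continuous Q P \<and> absolutely_continuous P Q")
    case False
    with cases cases' all_inf show ?thesis by auto
  next
    case True
    then have ac: "absolutely_continuous Q P" and ac': "absolutely_continuous P Q" by auto
    note null = RN_deriv_density_ratio(1)[OF x_meas y_meas x_nonneg y_nonneg P_def prob_P Q_def prob_Q ac]
    obtain n where n: "j = Suc n" "0 < n" using j by (cases j) auto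
    let ?X = "\<integral>\<^sup>+z. ennreal (x z ^ Suc n / y z ^ n) \<partial>M"
    have X: "enn2ereal ?X \<le> ereal_exp (ereal (real n) * ?e)"
      using fin(1)[of "real j"] j n by (intro moment_le_of_renyi[OF ac]) auto
    have X1: "1 \<le> enn2ereal ?X"
      using one_le_moment[OF ac, of n] by (metis less_eq_ennreal.rep_eq one_ennreal.rep_eq)
    have E1: "1 \<le> ereal_exp (ereal (real n) * ?e)" using X1 X by (rule order_trans)
    have "?I \<le> (\<integral>\<^sup>+z. ennreal (x z ^ Suc n / y z ^ n) + ennreal (y z) \<partial>M)"
    proof (rule nn_integral_mono)
      fix z
      have "\<bar>x z - y z\<bar> ^ Suc n \<le> (max (x z) (y z)) ^ Suc n"
        using x_nonneg[of z] y_nonneg[of z] by (intro power_mono) auto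
      also have "\<dots> \<le> x z ^ Suc n + y z ^ Suc n"
        using x_nonneg[of z] y_nonneg[of z] by (auto simp: max_def)
      finally have "\<bar>x z - y z\<bar> ^ Suc n / y z ^ n \<le> (x z ^ Suc n + y z ^ Suc n) / y z ^ n"
        using y_nonneg[of z] by (intro divide_right_mono) auto
      also have "\<dots> \<le> x z ^ Suc n / y z ^ n + y z"
        using y_nonneg[of z] n by (cases "y z = 0") (auto simp: add_divide_distrib)
      finally have "ennreal (\<bar>x z - y z\<bar> ^ Suc n / y z ^ n) \<le> ennreal (x z ^ Suc n / y z ^ n + y z)"
        by (rule ennreal_leI)
      then show "ennreal (\<bar>x z - y z\<bar> ^ j / y z ^ (j - 1)) \<le> ennreal (x z ^ Suc n / y z ^ n) + ennreal (y z)"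
        using x_nonneg[of z] y_nonneg[of z] by (simp add: n ennreal_plus del: power_Suc)
    qed
    also have "\<dots> = ?X + 1" by (simp add: nn_integral_add nn_integral_y del: power_Suc)
    finally have "enn2ereal ?I \<le> enn2ereal ?X + 1"
      by (simp only: less_eq_ennreal.rep_eq plus_ennreal.rep_eq one_ennreal.rep_eq)
    also have "\<dots> \<le> ereal_exp (ereal (real n) * ?e) + ereal_exp (ereal (real n) * ?e)"
      by (intro add_mono X E1)
    finally have I1: "enn2ereal ?I \<le> ereal_exp (ereal (real n) * ?e) * 2"
      by (cases "ereal_exp (ereal (real n) * ?e)") (auto simp: mult.commute)
    have I2: "enn2ereal ?I \<le> ereal_exp (ereal (real n) * ?e) * (ereal_exp (e \<infinity>) - 1) ^ j"
    proof (cases "e \<infinity> = \<infinity>")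
      case True
      then have "(ereal_exp (e \<infinity>) - 1) ^ j = \<infinity>" using j by (simp add: ereal_exp_def infinity_ereal_power)
      then show ?thesis using E1 by (cases "ereal_exp (ereal (real n) * ?e)") auto
    next
      case False
      obtain K where K: "e \<infinity> = ereal (ln K)" "1 \<le> K" "AE z in M. x z \<le> K * y z"
        using density_le_of_renyi[OF ac inf(1) False] by blast
      obtain K' where K': "e \<infinity> = ereal (ln K')" "1 \<le> K'" "AE z in M. y z \<le> K' * x z"
        using swap.density_le_of_renyi[OF ac' inf(2) False] by blast
      have "K' = K" using K K' by simp
      have "?I \<le> (\<integral>\<^sup>+z. ennreal ((K - 1) ^ j) * ennreal (y z) \<partial>M)"
      proof (rule nn_integral_mono_AE)
        show "AE z in M. ennreal (\<bar>x z - y z\<bar> ^ j / y z ^ (j - 1)) \<le> ennreal ((K - 1) ^ j) * ennreal (y z)"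
          using K(3) K'(3)
        proof eventually_elim
          case (elim z)
          \<comment> \<open>The reverse ratio bound gives a multiple of \<open>x z\<close>; it may
            be enlarged to \<open>y z\<close> when \<open>x z \<le> y z\<close>, and otherwise the
            left side is negative.\<close>
          have "y z - x z \<le> (K - 1) * y z"
          proof (cases "x z \<le> y z")
            case True
            have "y z - x z \<le> (K - 1) * x z" using elim(2) \<open>K' = K\<close> by (simp add: algebra_simps)
            also have "\<dots> \<le> (K - 1) * y z" using True K(2) by (intro mult_left_mono) auto
            finally show ?thesis .
          next
            case False
            then have "y z - x z \<le> 0" by simp
            also have "0 \<le> (K - 1) * y z" using K(2) y_nonneg by simp
            finally show ?thesis .
          qed
          moreover have "x z - y z \<le> (K - 1) * y z" using elim(1) by (simp add: algebra_simps)
          ultimately have "\<bar>x z - y z\<bar> \<le> (K - 1) * y z" by (simp add: abs_le_iff)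
          then have "\<bar>x z - y z\<bar> ^ j / y z ^ (j - 1) \<le> ((K - 1) * y z) ^ j / y z ^ (j - 1)"
            using y_nonneg[of z] by (intro divide_right_mono power_mono) auto
          also have "\<dots> \<le> (K - 1) ^ j * y z"
            using y_nonneg[of z] K(2) by (cases "y z = 0") (auto simp: n power_mult_distrib)
          finally have "ennreal (\<bar>x z - y z\<bar> ^ j / y z ^ (j - 1)) \<le> ennreal ((K - 1) ^ j * y z)"
            by (rule ennreal_leI)
          then show ?case using K(2) y_nonneg[of z] by (simp add: ennreal_mult)
        qed
      qed
      also have "\<dots> = ennreal ((K - 1) ^ j)" by (simp add: nn_integral_cmult nn_integral_y)
      finally have "enn2ereal ?I \<le> ereal ((K - 1) ^ j)"
        using K(2) by (simp add: less_eq_ennreal.rep_eq)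
      also have "\<dots> = 1 * (ereal_exp (e \<infinity>) - 1) ^ j" using K(1,2) by (simp add: one_ereal_def)
      also have "\<dots> \<le> ereal_exp (ereal (real n) * ?e) * (ereal_exp (e \<infinity>) - 1) ^ j"
        using E1 K(1,2) by (intro ereal_mult_right_mono) (auto simp: one_ereal_def)
      finally show ?thesis .
    qed
    have main: "enn2ereal ?I \<le> ereal_exp (ereal (real j - 1) * ?e) * min 2 ((ereal_exp (e \<infinity>) - 1) ^ j)"
      using ereal_mult_min_distrib[OF I1 I2] n by simp
    have "enn2ereal ?I \<le> 4 * (ereal_exp (e 2) - 1)" if "j = 2"
    proof -
      have n1: "n = 1" using n that by simp
      \<comment> \<open>Expanding the square: the cross term is added on the left, as twice the
        total mass of \<open>x\<close>, to avoid subtraction of extended nonnegative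
        numbers.\<close>
      have "?I + 2 = (\<integral>\<^sup>+z. ennreal (\<bar>x z - y z\<bar> ^ j / y z ^ (j - 1)) + 2 * ennreal (x z) \<partial>M)"
        by (simp add: nn_integral_add nn_integral_cmult nn_integral_x)
      also have "\<dots> = (\<integral>\<^sup>+z. ennreal (x z ^ Suc n / y z ^ n) + ennreal (y z) \<partial>M)"
      proof (rule nn_integral_cong_AE)
        show "AE z in M. ennreal (\<bar>x z - y z\<bar> ^ j / y z ^ (j - 1)) + 2 * ennreal (x z) =
            ennreal (x z ^ Suc n / y z ^ n) + ennreal (y z)"
          using null
        proof eventually_elim
          case (elim z)
          have "(x z - y z)\<^sup>2 / y z + 2 * x z = (x z)\<^sup>2 / y z + y z"
          proof (cases "y z = 0")
            case False
            have "(x z - y z)\<^sup>2 + 2 * x z * y z = (x z)\<^sup>2 + y z * y z"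
              by (simp add: power2_eq_square algebra_simps)
            then have "((x z - y z)\<^sup>2 + 2 * x z * y z) / y z = ((x z)\<^sup>2 + y z * y z) / y z" by simp
            with False show ?thesis by (simp add: add_divide_distrib)
          qed (use elim in simp)
          then have "ennreal ((x z - y z)\<^sup>2 / y z + 2 * x z) = ennreal ((x z)\<^sup>2 / y z + y z)" by simp
          then show ?case using x_nonneg[of z] y_nonneg[of z]
            by (simp add: that n1 ennreal_mult numeral_2_eq_2[symmetric])
        qed
      qed
      also have "\<dots> = ?X + 1" by (simp add: nn_integral_add nn_integral_y del: power_Suc)
      finally have "enn2ereal (?I + 2) = enn2ereal (?X + 1)" by (rule arg_cong)
      then have eq: "enn2ereal ?I + 2 = enn2ereal ?X + 1"
        by (simp only: one_ennreal.rep_eq plus_ennreal.rep_eq enn2ereal_numeral)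
      have X2: "enn2ereal ?X \<le> ereal_exp (e 2)" using X that n1 by simp
      show ?thesis
      proof (cases "ereal_exp (e 2)")
        case (real r)
        with X1 X2 obtain s where s: "enn2ereal ?X = ereal s" "1 \<le> s" "s \<le> r" by (cases "enn2ereal ?X") auto
        with eq obtain i where i: "enn2ereal ?I = ereal i" "i + 2 = s + 1" by (cases "enn2ereal ?I") (auto simp: one_ereal_def)
        \<comment> \<open>The integral is \<open>s - 1\<close>, hence at most \<open>r - 1\<close>;
          the factor 4 is slack, because \<open>r\<close> is at least 1.\<close>
        show ?thesis using s i real by (simp add: one_ereal_def)
      qed (use X1 X2 in auto)
    qed
    then show ?thesis using main by (auto simp: moment_term_def Let_def)
  qed
  show "AE z in M. y z = 0 \<longrightarrow> x z = 0" if "moment_term e j \<noteq> \<infinity>"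
    using cases all_inf that RN_deriv_density_ratio(1)[OF x_meas y_meas x_nonneg y_nonneg P_def prob_P Q_def prob_Q] by auto
qed

text \<open>For arbitrary \<open>e\<close> the term can be negative. An actual pair of laws rules
  this out, because the term then dominates an integral of a nonnegative function or is
  infinite.\<close>

lemma moment_term_nonneg:
  fixes e :: "ereal \<Rightarrow> ereal"
  assumes P: "prob_space P" and Q: "prob_space Q" and sets: "sets P = sets Q"
    and PQ: "\<And>a. 1 < a \<Longrightarrow> renyi_divergence a P Q \<le> e a"
    and QP: "\<And>a. 1 < a \<Longrightarrow> renyi_divergence a Q P \<le> e a"
    and j: "2 \<le> j"
  shows "0 \<le> moment_term e j"
proof (cases "absolutely_continuous Q P")
  case True
  have "density Q (\<lambda>_. ennreal 1) = Q" by (intro measure_eqI) (auto simp: emeasure_density)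
  then have "density_pair Q P Q (\<lambda>z. enn2real (RN_deriv Q P z)) (\<lambda>_. 1)"
    using P Q density_enn2real_RN_deriv[OF P Q sets True] by (intro density_pair.intro) auto
  from moment_term_bound(1)[OF this PQ QP j] show ?thesis
    using enn2ereal_nonneg order_trans by blast
next
  case False
  have "e (ereal a) = \<infinity>" if "1 < a" for a
    using PQ[of "ereal a"] False that by (auto simp: renyi_divergence_def renyi_finite_def one_ereal_def)
  from this[of 2] this[of "real j"] have "e 2 = \<infinity>" "e (ereal (real j)) = \<infinity>" using j by auto
  moreover have "renyi_finite 2 P Q \<le> e \<infinity>"
    using renyi_finite_le_renyi_infinity[OF P Q sets, of 2] PQ[of \<infinity>] by auto
  then have "e \<infinity> = \<infinity>" using False by (simp add: renyi_finite_def)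
  ultimately show ?thesis using moment_term_eq_infinity[of j e] j by simp
qed

section \<open>Mixtures of adjacent pairs\<close>

text \<open>By \<open>power_tangent\<close>, the perspective \<open>u ^ Suc n / z ^ n\<close> lies
  above the linear function \<open>Suc n * t ^ n * u - n * t ^ Suc n * z\<close> for every
  \<open>t\<close>, with equality on the ray \<open>u = t * z\<close>. Taking \<open>t\<close> as
  the ratio of the two totals makes the bound exact for the totals. The condition
  \<open>null\<close> guards against division by 0.\<close>

lemma perspective_power_sum_le:
  fixes w u z :: "'i \<Rightarrow> real"
  assumes fin: "finite I" and w: "\<And>i. i \<in> I \<Longrightarrow> 0 \<le> w i" and u: "\<And>i. i \<in> I \<Longrightarrow> 0 \<le> u i"
    and z: "\<And>i. i \<in> I \<Longrightarrow> 0 \<le> z i" and null: "\<And>i. i \<in> I \<Longrightarrow> z i = 0 \<Longrightarrow> u i = 0"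
  shows "(\<Sum>i\<in>I. w i * u i) ^ Suc n / (\<Sum>i\<in>I. w i * z i) ^ n \<le> (\<Sum>i\<in>I. w i * (u i ^ Suc n / z i ^ n))"
proof -
  let ?U = "\<Sum>i\<in>I. w i * u i" and ?Z = "\<Sum>i\<in>I. w i * z i"
  have Z0: "0 \<le> ?Z" and U0: "0 \<le> ?U" using w u z by (auto intro!: sum_nonneg)
  show ?thesis
  proof (cases "?Z = 0")
    case True
    then have "\<forall>i\<in>I. w i * z i = 0" using fin w z by (subst (asm) sum_nonneg_eq_0_iff) auto
    then have "?U = 0" using null by (intro sum.neutral) auto
    moreover have "0 \<le> (\<Sum>i\<in>I. w i * (u i ^ Suc n / z i ^ n))"
      using w u z by (intro sum_nonneg mult_nonneg_nonneg divide_nonneg_nonneg zero_le_power) auto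
    ultimately show ?thesis by simp
  next
    case False
    with Z0 have Z: "0 < ?Z" by simp
    define t where "t = ?U / ?Z"
    have t: "0 \<le> t" using U0 Z0 by (simp add: t_def)
    have "?U ^ Suc n / ?Z ^ n = t ^ n * ?U" by (simp add: t_def power_divide)
    also have "\<dots> = real (Suc n) * t ^ n * ?U - real n * t ^ n * (t * ?Z)"
      using Z by (simp add: t_def algebra_simps)
    also have "\<dots> = (\<Sum>i\<in>I. w i * (real (Suc n) * t ^ n * u i - real n * t ^ Suc n * z i))"
      by (simp add: sum_distrib_left sum_subtractf[symmetric] right_diff_distrib mult_ac)
    also have "\<dots> \<le> (\<Sum>i\<in>I. w i * (u i ^ Suc n / z i ^ n))"
    proof (intro sum_mono mult_left_mono w)
      fix i assume i: "i \<in> I"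
      show "real (Suc n) * t ^ n * u i - real n * t ^ Suc n * z i \<le> u i ^ Suc n / z i ^ n"
      proof (cases "z i = 0")
        case False
        with z[OF i] have zi: "0 < z i" by simp
        have "real (Suc n) * (t * z i) ^ n * u i \<le> u i ^ Suc n + real n * (t * z i) ^ Suc n"
          using t zi u[OF i] by (intro power_tangent) auto
        then have "z i ^ n * (real (Suc n) * t ^ n * u i - real n * t ^ Suc n * z i) \<le> u i ^ Suc n"
          by (simp add: power_mult_distrib right_diff_distrib mult_ac del: of_nat_Suc)
        then show ?thesis using zi by (simp add: pos_le_divide_eq mult.commute del: of_nat_Suc)
      qed (use null[OF i] in simp)
    qed
    finally show ?thesis .
  qed
qed

text \<open>The case of two points with equal numerators: it separates a mixed denominator into pure
  ones.\<close>

lemma perspective_power_segment_le: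
  fixes g d x y :: real
  assumes "0 \<le> g" "g \<le> 1" "0 \<le> d" "0 \<le> x" "0 \<le> y" "x = 0 \<Longrightarrow> d = 0" "y = 0 \<Longrightarrow> d = 0"
  shows "d ^ Suc n / ((1 - g) * x + g * y) ^ n \<le> (1 - g) * (d ^ Suc n / x ^ n) + g * (d ^ Suc n / y ^ n)"
proof -
  have "(\<Sum>b\<in>(UNIV :: bool set). (if b then g else 1 - g) * d) ^ Suc n /
      (\<Sum>b\<in>(UNIV :: bool set). (if b then g else 1 - g) * (if b then y else x)) ^ n \<le>
      (\<Sum>b\<in>(UNIV :: bool set). (if b then g else 1 - g) * (d ^ Suc n / (if b then y else x) ^ n))"
    using assms by (intro perspective_power_sum_le) (auto split: if_splits)
  moreover have "g * d + (1 - g) * d = d" by (simp add: algebra_simps)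
  ultimately show ?thesis by (simp add: UNIV_bool add.commute del: power_Suc)
qed

text \<open>The parameter \<open>g\<close> covers both directions of adjacency: 0 when the reference
  law is the average of the \<open>X i\<close>, and the sampling probability when it is the mixture.
  Convexity is used twice, first over the pairs and then along the segment between the two members
  of a pair, which is where both \<open>bX\<close> and \<open>bY\<close> enter.\<close>

lemma nn_integral_mixture_deviation_le:
  fixes X Y :: "'i \<Rightarrow> 'a \<Rightarrow> real"
  assumes I: "finite I" "I \<noteq> {}"
    and X [measurable]: "\<And>i. X i \<in> borel_measurable M" and Y [measurable]: "\<And>i. Y i \<in> borel_measurable M"
    and X0: "\<And>i z. 0 \<le> X i z" and Y0: "\<And>i z. 0 \<le> Y i z"
    and null: "\<And>i. i \<in> I \<Longrightarrow> AE z in M. X i z = 0 \<longleftrightarrow> Y i z = 0"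
    and g: "0 \<le> g" "g \<le> 1" and b: "0 \<le> b"
    and bX: "\<And>i. i \<in> I \<Longrightarrow> (\<integral>\<^sup>+z. ennreal (\<bar>X i z - Y i z\<bar> ^ Suc n / X i z ^ n) \<partial>M) \<le> ennreal b"
    and bY: "\<And>i. i \<in> I \<Longrightarrow> (\<integral>\<^sup>+z. ennreal (\<bar>X i z - Y i z\<bar> ^ Suc n / Y i z ^ n) \<partial>M) \<le> ennreal b"
    and p: "\<And>z. p z = (\<Sum>i\<in>I. X i z) / real (card I)"
    and p': "\<And>z. p' z = (\<Sum>i\<in>I. Y i z) / real (card I)"
  shows "(\<integral>\<^sup>+z. ennreal (\<bar>p z - p' z\<bar> ^ Suc n / ((1 - g) * p z + g * p' z) ^ n) \<partial>M) \<le> ennreal b"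
proof -
  define w where "w = 1 / real (card I)"
  have w: "0 \<le> w" "real (card I) * w = 1" using I by (auto simp: w_def)
  define AX where "AX i z = \<bar>X i z - Y i z\<bar> ^ Suc n / X i z ^ n" for i z
  define AY where "AY i z = \<bar>X i z - Y i z\<bar> ^ Suc n / Y i z ^ n" for i z
  have meas [measurable]: "AX i \<in> borel_measurable M" "AY i \<in> borel_measurable M" for i
    unfolding AX_def[abs_def] AY_def[abs_def] by measurable
  have nonneg: "0 \<le> AX i z" "0 \<le> AY i z" for i z
    using X0 Y0 by (auto simp: AX_def AY_def simp del: power_Suc)
  have "AE z in M. \<forall>i\<in>I. X i z = 0 \<longleftrightarrow> Y i z = 0"
    using I null by (intro AE_finite_allI) auto
  then have "AE z in M. \<bar>p z - p' z\<bar> ^ Suc n / ((1 - g) * p z + g * p' z) ^ n \<le>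
      (\<Sum>i\<in>I. w * ((1 - g) * AX i z + g * AY i z))"
  proof eventually_elim
    case (elim z)
    have pz: "p z = (\<Sum>i\<in>I. w * X i z)" and pz': "p' z = (\<Sum>i\<in>I. w * Y i z)"
      by (auto simp: p p' w_def sum_divide_distrib)
    have denom: "(1 - g) * p z + g * p' z = (\<Sum>i\<in>I. w * ((1 - g) * X i z + g * Y i z))"
      unfolding pz pz' by (simp add: sum_distrib_left sum.distrib distrib_left mult_ac)
    have "p z - p' z = (\<Sum>i\<in>I. w * (X i z - Y i z))"
      unfolding pz pz' by (simp add: sum_subtractf right_diff_distrib)
    then have "\<bar>p z - p' z\<bar> \<le> (\<Sum>i\<in>I. w * \<bar>X i z - Y i z\<bar>)"
      using w sum_abs[of "\<lambda>i. w * (X i z - Y i z)" I] by (simp add: abs_mult)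
    then have "\<bar>p z - p' z\<bar> ^ Suc n / ((1 - g) * p z + g * p' z) ^ n \<le>
        (\<Sum>i\<in>I. w * \<bar>X i z - Y i z\<bar>) ^ Suc n / (\<Sum>i\<in>I. w * ((1 - g) * X i z + g * Y i z)) ^ n"
      unfolding denom using w g X0 Y0
      by (intro divide_right_mono power_mono zero_le_power sum_nonneg mult_nonneg_nonneg add_nonneg_nonneg) auto
    also have "\<dots> \<le> (\<Sum>i\<in>I. w * (\<bar>X i z - Y i z\<bar> ^ Suc n / ((1 - g) * X i z + g * Y i z) ^ n))"
    proof (rule perspective_power_sum_le)
      fix i assume i: "i \<in> I" and 0: "(1 - g) * X i z + g * Y i z = 0"
      then have "(1 - g) * X i z = 0" "g * Y i z = 0"
        using g X0[of i z] Y0[of i z] by (auto simp: add_nonneg_eq_0_iff)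
      then show "\<bar>X i z - Y i z\<bar> = 0" using elim i by (cases "g = 0") auto
    qed (use I w g X0 Y0 in auto)
    also have "\<dots> \<le> (\<Sum>i\<in>I. w * ((1 - g) * AX i z + g * AY i z))"
      unfolding AX_def AY_def using w g X0 Y0 elim
      by (intro sum_mono mult_left_mono perspective_power_segment_le) auto
    finally show ?case .
  qed
  then have "(\<integral>\<^sup>+z. ennreal (\<bar>p z - p' z\<bar> ^ Suc n / ((1 - g) * p z + g * p' z) ^ n) \<partial>M) \<le>
      (\<integral>\<^sup>+z. ennreal (\<Sum>i\<in>I. w * ((1 - g) * AX i z + g * AY i z)) \<partial>M)"
    by (intro nn_integral_mono_AE) (auto elim!: eventually_mono intro: ennreal_leI)
  also have "\<dots> = (\<integral>\<^sup>+z. (\<Sum>i\<in>I. ennreal w * (ennreal (1 - g) * ennreal (AX i z) + ennreal g * ennreal (AY i z))) \<partial>M)"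
  proof (rule nn_integral_cong)
    fix z
    have "ennreal (\<Sum>i\<in>I. w * ((1 - g) * AX i z + g * AY i z)) = (\<Sum>i\<in>I. ennreal (w * ((1 - g) * AX i z + g * AY i z)))"
      using w g nonneg by (subst sum_ennreal) auto
    then show "ennreal (\<Sum>i\<in>I. w * ((1 - g) * AX i z + g * AY i z)) =
        (\<Sum>i\<in>I. ennreal w * (ennreal (1 - g) * ennreal (AX i z) + ennreal g * ennreal (AY i z)))"
      using w g nonneg by (simp add: ennreal_mult ennreal_plus)
  qed
  also have "\<dots> = (\<Sum>i\<in>I. ennreal w * (ennreal (1 - g) * (\<integral>\<^sup>+z. ennreal (AX i z) \<partial>M) + ennreal g * (\<integral>\<^sup>+z. ennreal (AY i z) \<partial>M)))"
    by (simp add: nn_integral_sum nn_integral_cmult nn_integral_add)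
  also have "\<dots> \<le> (\<Sum>i\<in>I. ennreal w * (ennreal (1 - g) * ennreal b + ennreal g * ennreal b))"
    using bX bY by (intro sum_mono mult_left_mono add_mono) (auto simp: AX_def AY_def)
  also have "ennreal (1 - g) * ennreal b + ennreal g * ennreal b = ennreal b"
    using g by (simp add: distrib_right[symmetric] ennreal_plus[symmetric] del: ennreal_plus)
  also have "(\<Sum>i\<in>I. ennreal w * ennreal b) = ennreal b"
    using w b by (simp add: ennreal_of_nat_eq_real_of_nat ennreal_mult[symmetric] mult.assoc[symmetric])
  finally show ?thesis .
qed

lemma binomial_moment_le:
  fixes U V d :: "'a \<Rightarrow> real"
  assumes [measurable]: "U \<in> borel_measurable M" "V \<in> borel_measurable M" "d \<in> borel_measurable M"
    and U0: "\<And>z. 0 \<le> U z" and V0: "\<And>z. 0 \<le> V z"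
    and U: "(\<integral>\<^sup>+z. ennreal (U z) \<partial>M) = 1" and V: "(\<integral>\<^sup>+z. ennreal (V z) \<partial>M) = 1"
    and UV: "\<And>z. U z = V z + \<gamma> * d z" and \<gamma>: "0 \<le> \<gamma>"
    and null: "AE z in M. V z = 0 \<longrightarrow> U z = 0"
    and b0: "\<And>j. 0 \<le> b j"
    and b: "\<And>j. 2 \<le> j \<Longrightarrow> j \<le> Suc n \<Longrightarrow> (\<integral>\<^sup>+z. ennreal (\<bar>d z\<bar> ^ j / V z ^ (j - 1)) \<partial>M) \<le> ennreal (b j)"
  shows "integrable M (\<lambda>z. U z ^ Suc n / V z ^ n)"
    and "(\<integral>z. U z ^ Suc n / V z ^ n \<partial>M) \<le> 1 + (\<Sum>j=2..Suc n. real (Suc n choose j) * \<gamma> ^ j * b j)"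
proof -
  have intU: "integrable M U" "(\<integral>z. U z \<partial>M) = 1" and intV: "integrable M V" "(\<integral>z. V z \<partial>M) = 1"
    using U V U0 V0 by (auto intro!: integrableI_nonneg simp: integral_eq_nn_integral)
  define a where "a j z = \<bar>d z\<bar> ^ j / V z ^ (j - 1)" for j z
  have a_meas [measurable]: "a j \<in> borel_measurable M" for j unfolding a_def[abs_def] by measurable
  have a0: "0 \<le> a j z" for j z using V0 by (simp add: a_def)
  have inta: "integrable M (a j)" "(\<integral>z. a j z \<partial>M) \<le> b j" if "2 \<le> j" "j \<le> Suc n" for j
  proof -
    have le: "(\<integral>\<^sup>+z. ennreal (a j z) \<partial>M) \<le> ennreal (b j)" using b[OF that] by (simp add: a_def)
    then show int: "integrable M (a j)"
      using a0 by (intro integrableI_nonneg) (auto simp: less_top[symmetric] top_unique)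
    show "(\<integral>z. a j z \<partial>M) \<le> b j"
      using le a0 b0 int by (subst (asm) nn_integral_eq_integral) (auto simp: ennreal_le_iff)
  qed
  \<comment> \<open>The linear term keeps its sign, so that it integrates to zero; only the terms
    from \<open>j = 2\<close> on are replaced by absolute values.\<close>
  define G where "G z = V z + real (Suc n) * (U z - V z) + (\<Sum>j=2..Suc n. real (Suc n choose j) * \<gamma> ^ j * a j z)" for z
  have intG: "integrable M G"
    unfolding G_def[abs_def] using intU intV inta
    by (intro Bochner_Integration.integrable_add Bochner_Integration.integrable_diff
        integrable_mult_right Bochner_Integration.integrable_sum) auto
  have le: "AE z in M. U z ^ Suc n / V z ^ n \<le> G z"
    using null
  proof eventually_elim
    case (elim z)
    show ?case
    proof (cases "V z = 0")
      case True
      have "0 \<le> (\<Sum>j=2..Suc n. real (Suc n choose j) * \<gamma> ^ j * a j z)"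
        using a0 \<gamma> by (intro sum_nonneg mult_nonneg_nonneg) auto
      then show ?thesis using True elim by (simp add: G_def del: sum.cl_ivl_Suc)
    next
      case False
      then have v: "0 < V z" using V0[of z] by simp
      let ?f = "\<lambda>j. real (Suc n choose j) * (\<gamma> * d z) ^ j * V z ^ (Suc n - j) / V z ^ n"
      have "U z ^ Suc n / V z ^ n = (\<gamma> * d z + V z) ^ Suc n / V z ^ n" by (simp add: UV add.commute)
      also have "\<dots> = (\<Sum>j\<le>Suc n. ?f j)"
        by (subst binomial_ring) (rule sum_divide_distrib)
      also have "\<dots> = ?f 0 + (?f 1 + (\<Sum>j=2..Suc n. ?f j))"
        by (simp add: atMost_atLeast0 sum.atLeast_Suc_atMost numeral_2_eq_2 del: power_Suc binomial_Suc_Suc)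
      also have "?f 0 = V z" using v by simp
      also have "?f 1 = real (Suc n) * (U z - V z)" using v by (simp add: UV)
      also have "(\<Sum>j=2..Suc n. ?f j) \<le> (\<Sum>j=2..Suc n. real (Suc n choose j) * \<gamma> ^ j * a j z)"
      proof (rule sum_mono)
        fix j assume j: "j \<in> {2..Suc n}"
        have "n = (j - 1) + (Suc n - j)" using j by auto
        then have "V z ^ n = V z ^ (j - 1) * V z ^ (Suc n - j)" by (metis power_add)
        then have "?f j = real (Suc n choose j) * \<gamma> ^ j * (d z ^ j / V z ^ (j - 1))"
          using v by (simp add: power_mult_distrib)
        also have "\<dots> \<le> real (Suc n choose j) * \<gamma> ^ j * a j z"
          unfolding a_def using v \<gamma> abs_ge_self[of "d z ^ j"]
          by (intro mult_left_mono divide_right_mono) (auto simp: power_abs)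
        finally show "?f j \<le> real (Suc n choose j) * \<gamma> ^ j * a j z" .
      qed
      finally show ?thesis by (simp add: G_def)
    qed
  qed
  have pos: "0 \<le> U z ^ Suc n / V z ^ n" for z using U0 V0 by simp
  show int: "integrable M (\<lambda>z. U z ^ Suc n / V z ^ n)"
  proof (rule Bochner_Integration.integrable_bound[OF intG])
    show "AE z in M. norm (U z ^ Suc n / V z ^ n) \<le> norm (G z)"
      using le unfolding real_norm_def abs_of_nonneg[OF pos]
      by eventually_elim (rule order_trans[OF _ abs_ge_self])
  qed measurable
  have "(\<integral>z. U z ^ Suc n / V z ^ n \<partial>M) \<le> (\<integral>z. G z \<partial>M)"
    by (rule integral_mono_AE[OF int intG le])
  also have "\<dots> = 1 + (\<Sum>j=2..Suc n. real (Suc n choose j) * \<gamma> ^ j * (\<integral>z. a j z \<partial>M))"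
    unfolding G_def using intU intV inta
    by (subst Bochner_Integration.integral_add)
      (auto simp: Bochner_Integration.integral_sum simp del: of_nat_Suc binomial_Suc_Suc sum.cl_ivl_Suc)
  also have "\<dots> \<le> 1 + (\<Sum>j=2..Suc n. real (Suc n choose j) * \<gamma> ^ j * b j)"
    using inta \<gamma> by (intro add_left_mono sum_mono mult_left_mono) auto
  finally show "(\<integral>z. U z ^ Suc n / V z ^ n \<partial>M) \<le> 1 + (\<Sum>j=2..Suc n. real (Suc n choose j) * \<gamma> ^ j * b j)" .
qed

section \<open>Subsampling\<close>

lemma bind_pmf_of_set_eq_density:
  fixes N :: "'i \<Rightarrow> 'a measure" and x :: "'i \<Rightarrow> 'a \<Rightarrow> real"
  assumes A: "finite A" "A \<noteq> {}" and N: "\<And>i. N i \<in> space (prob_algebra B)" and M: "sets M = sets B"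
    and x [measurable]: "\<And>i. x i \<in> borel_measurable M" and x0: "\<And>i z. 0 \<le> x i z"
    and dens: "\<And>i. i \<in> A \<Longrightarrow> N i = density M (x i)"
  shows "Giry_Monad.bind (measure_pmf (pmf_of_set A)) N = density M (\<lambda>z. ennreal ((\<Sum>i\<in>A. x i z) / real (card A)))"
proof (rule measure_eqI)
  have N': "N \<in> measure_pmf (pmf_of_set A) \<rightarrow>\<^sub>M subprob_algebra B"
    using N by (auto simp: measurable_def space_prob_algebra space_subprob_algebra intro: prob_space_imp_subprob_space)
  show sets: "sets (Giry_Monad.bind (measure_pmf (pmf_of_set A)) N) =
      sets (density M (\<lambda>z. ennreal ((\<Sum>i\<in>A. x i z) / real (card A))))"
    using N M by (subst sets_bind[where N = B]) (auto simp: space_prob_algebra)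
  fix E assume "E \<in> sets (Giry_Monad.bind (measure_pmf (pmf_of_set A)) N)"
  then have E: "E \<in> sets B" "E \<in> sets M" unfolding sets using M by auto
  have c: "0 < real (card A)" using A by (simp add: card_gt_0_iff)
  have "emeasure (Giry_Monad.bind (measure_pmf (pmf_of_set A)) N) E = (\<Sum>i\<in>A. emeasure (N i) E) / of_nat (card A)"
    using emeasure_bind[OF _ N' E(1)] A by (simp add: nn_integral_pmf_of_set)
  also have "\<dots> = (\<Sum>i\<in>A. ennreal (1 / real (card A)) * (\<integral>\<^sup>+z. ennreal (x i z) * indicator E z \<partial>M))"
    unfolding divide_ennreal_def ennreal_of_nat_eq_real_of_nat inverse_ennreal[OF c] inverse_eq_divide sum_distrib_right
    using dens E by (intro sum.cong) (auto simp: emeasure_density mult.commute)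
  also have "\<dots> = (\<integral>\<^sup>+z. (\<Sum>i\<in>A. ennreal (1 / real (card A)) * (ennreal (x i z) * indicator E z)) \<partial>M)"
    using E by (simp add: nn_integral_sum nn_integral_cmult)
  also have "\<dots> = (\<integral>\<^sup>+z. ennreal ((\<Sum>i\<in>A. x i z) / real (card A)) * indicator E z \<partial>M)"
  proof (rule nn_integral_cong)
    fix z
    have "(\<Sum>i\<in>A. ennreal (1 / real (card A)) * ennreal (x i z)) = (\<Sum>i\<in>A. ennreal (1 / real (card A) * x i z))"
      using x0 by (intro sum.cong ennreal_mult[symmetric]) auto
    also have "\<dots> = ennreal (\<Sum>i\<in>A. 1 / real (card A) * x i z)"
      using x0 by (intro sum_ennreal) auto
    also have "(\<Sum>i\<in>A. 1 / real (card A) * x i z) = (\<Sum>i\<in>A. x i z) / real (card A)"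
      by (simp add: sum_divide_distrib)
    finally show "(\<Sum>i\<in>A. ennreal (1 / real (card A)) * (ennreal (x i z) * indicator E z)) =
        ennreal ((\<Sum>i\<in>A. x i z) / real (card A)) * indicator E z"
      by (simp add: mult.assoc[symmetric] sum_distrib_right[symmetric])
  qed
  also have "\<dots> = emeasure (density M (\<lambda>z. ennreal ((\<Sum>i\<in>A. x i z) / real (card A)))) E"
    using E by (subst emeasure_density) auto
  finally show "emeasure (Giry_Monad.bind (measure_pmf (pmf_of_set A)) N) E =
      emeasure (density M (\<lambda>z. ennreal ((\<Sum>i\<in>A. x i z) / real (card A)))) E" .
qed

lemma absolutely_continuous_bind_pmf:
  assumes "i \<in> set_pmf p" and N: "\<And>i. N i \<in> space (prob_algebra B)"
  shows "absolutely_continuous (Giry_Monad.bind (measure_pmf p) N) (N i)"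
  unfolding absolutely_continuous_def
proof
  have N': "N \<in> measure_pmf p \<rightarrow>\<^sub>M subprob_algebra B"
    using N by (auto simp: measurable_def space_prob_algebra space_subprob_algebra intro: prob_space_imp_subprob_space)
  have sets: "sets (Giry_Monad.bind (measure_pmf p) N) = sets B"
    using N by (subst sets_bind[where N = B]) (auto simp: space_prob_algebra)
  fix E assume E: "E \<in> null_sets (Giry_Monad.bind (measure_pmf p) N)"
  then have E': "E \<in> sets B" using sets by auto
  with E have "(\<integral>\<^sup>+i. emeasure (N i) E \<partial>measure_pmf p) = 0"
    using emeasure_bind[OF _ N' E'] by auto
  then have "AE i in measure_pmf p. emeasure (N i) E = 0"
    by (subst (asm) nn_integral_0_iff_AE) auto
  then show "E \<in> null_sets (N i)"
    using assms(1) N[of i] E' by (auto simp: AE_measure_pmf_iff space_prob_algebra)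
qed

text \<open>Double counting: a pair of a sample and one of its elements corresponds to a smaller set
  \<open>R\<close> and an element of \<open>D\<close> outside it, and each \<open>R\<close> leaves
  \<open>card D - (m - 1)\<close> choices.\<close>

lemma sum_subsets_remove:
  fixes f :: "'c set \<Rightarrow> real"
  assumes D: "finite D" and m: "1 \<le> m"
  shows "(\<Sum>(S, a)\<in>(SIGMA S:{S. S \<subseteq> D \<and> card S = m}. S). f (S - {a})) =
    real (card D - (m - 1)) * (\<Sum>R | R \<subseteq> D \<and> card R = m - 1. f R)"
proof -
  have finD: "finite S" if "S \<subseteq> D" for S using that D finite_subset by blast
  have "(\<Sum>(S, a)\<in>(SIGMA S:{S. S \<subseteq> D \<and> card S = m}. S). f (S - {a})) =
      (\<Sum>(R, a)\<in>(SIGMA R:{R. R \<subseteq> D \<and> card R = m - 1}. D - R). f R)"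
    using m finD
    by (intro sum.reindex_bij_witness[where i = "\<lambda>(R, a). (insert a R, a)" and j = "\<lambda>(S, a). (S - {a}, a)"])
      (auto simp: card_insert_if)
  also have "\<dots> = (\<Sum>R | R \<subseteq> D \<and> card R = m - 1. \<Sum>a\<in>D - R. f R)"
    using D by (subst sum.Sigma) auto
  also have "\<dots> = (\<Sum>R | R \<subseteq> D \<and> card R = m - 1. real (card D - (m - 1)) * f R)"
    using finD by (intro sum.cong) (auto simp: card_Diff_subset)
  finally show ?thesis by (simp add: sum_distrib_left)
qed

lemma subsets_insert_eq:
  assumes "c \<notin> D" "finite D" "1 \<le> m"
  shows "{S. S \<subseteq> insert c D \<and> card S = m} =
    {S. S \<subseteq> D \<and> card S = m} \<union> insert c ` {R. R \<subseteq> D \<and> card R = m - 1}" (is "?L = ?A \<union> ?B")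
proof
  show "?L \<subseteq> ?A \<union> ?B"
  proof
    fix S assume S: "S \<in> ?L"
    show "S \<in> ?A \<union> ?B"
    proof (cases "c \<in> S")
      case True
      then have "S = insert c (S - {c})" "S - {c} \<subseteq> D" "card (S - {c}) = m - 1" using S by auto
      then show ?thesis by blast
    qed (use S in auto)
  qed
  show "?A \<union> ?B \<subseteq> ?L"
    using assms finite_subset[OF _ assms(2)] by (auto simp: card_insert_if)
qed

text \<open>Pairing each sample \<open>S\<close> from \<open>D\<close> with the samples in which \<open>c\<close> displaces one element of \<open>S\<close>
  writes the mixture \<open>P'\<close> over the samples from \<open>insert c D\<close> as \<open>(1 - \<gamma>) P + \<gamma> P\<^sub>c\<close>, with \<open>P\<close> and
  \<open>P\<^sub>c\<close> averages over adjacent pairs.\<close>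

lemma moment_bound_subsampling:
  fixes N :: "'c set \<Rightarrow> 'b measure" and e :: "ereal \<Rightarrow> ereal" and q :: real
  assumes D: "finite D" "c \<notin> D" "1 \<le> m" "m \<le> card D"
    and N: "\<And>S. N S \<in> space (prob_algebra B)"
    and rdp: "\<And>S S' a. sample_adjacent m S S' \<Longrightarrow> 1 < a \<Longrightarrow> renyi_divergence a (N S) (N S') \<le> e a"
    and b: "\<And>j. 2 \<le> j \<Longrightarrow> j \<le> Suc n \<Longrightarrow> moment_term e j = ereal (b j)" and b0: "\<And>j. 0 \<le> b j"
    and q: "real m / real (Suc (card D)) \<le> q" and n: "0 < n"
  defines "C \<equiv> 1 + (\<Sum>j=2..Suc n. real (Suc n choose j) * q ^ j * b j)"
    and "P \<equiv> Giry_Monad.bind (measure_pmf (sample_clients m D)) N"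
    and "P' \<equiv> Giry_Monad.bind (measure_pmf (sample_clients m (insert c D))) N"
  shows "moment_bound n C P P'" and "moment_bound n C P' P"
proof -
  define A\<^sub>0 where "A\<^sub>0 = {S. S \<subseteq> D \<and> card S = m}"
  define R\<^sub>1 where "R\<^sub>1 = {R. R \<subseteq> D \<and> card R = m - 1}"
  define A\<^sub>1 where "A\<^sub>1 = insert c ` R\<^sub>1"
  define F where "F = {S. S \<subseteq> insert c D \<and> card S = m}"
  define r where "r = card D - (m - 1)"
  have r: "0 < r" using D by (simp add: r_def)
  have F: "F = A\<^sub>0 \<union> A\<^sub>1" "A\<^sub>0 \<inter> A\<^sub>1 = {}"
    using subsets_insert_eq[of c D m] D by (auto simp: F_def A\<^sub>0_def A\<^sub>1_def R\<^sub>1_def)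
  have fin: "finite A\<^sub>0" "finite R\<^sub>1" "finite A\<^sub>1" "finite F"
    using D by (auto simp: A\<^sub>0_def R\<^sub>1_def A\<^sub>1_def F_def)
  have ne0: "A\<^sub>0 \<noteq> {}" using obtain_subset_with_card_n[OF D(4)] by (auto simp: A\<^sub>0_def)
  then have neF: "F \<noteq> {}" using F by auto
  have inj: "inj_on (insert c) R\<^sub>1" using D by (auto simp: inj_on_def R\<^sub>1_def)
  have P: "P = Giry_Monad.bind (measure_pmf (pmf_of_set A\<^sub>0)) N" and P': "P' = Giry_Monad.bind (measure_pmf (pmf_of_set F)) N"
    by (auto simp: P_def P'_def sample_clients_def A\<^sub>0_def F_def)
  have Nsub: "N \<in> count_space UNIV \<rightarrow>\<^sub>M prob_algebra B" using N by (auto simp: measurable_def)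
  have Pprob: "Giry_Monad.bind (measure_pmf p) N \<in> space (prob_algebra B)" for p :: "'c set pmf"
    using prob_space_bind'[OF _ Nsub, of "measure_pmf p"] sets_bind'[OF _ Nsub, of "measure_pmf p"]
    by (simp add: space_prob_algebra prob_space_measure_pmf)
  have prob: "prob_space (N S)" "sets (N S) = sets B" for S using N[of S] by (auto simp: space_prob_algebra)
  \<comment> \<open>Every sample from either population has positive probability under
    \<open>P'\<close>, so this single probability measure dominates all the laws involved.\<close>
  define M where "M = P'"
  have M: "prob_space M" "sets M = sets B" using Pprob by (auto simp: M_def P' space_prob_algebra)
  define x where "x S z = enn2real (RN_deriv M (N S) z)" for S z
  have x_meas [measurable]: "x S \<in> borel_measurable M" for S unfolding x_def[abs_def] by measurable
  have x0: "0 \<le> x S z" for S z by (simp add: x_def)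
  have dens: "N S = density M (x S)" if "S \<in> F" for S
  proof -
    have "absolutely_continuous M (N S)"
      unfolding M_def P' using that fin neF by (intro absolutely_continuous_bind_pmf[OF _ N]) (auto simp: set_pmf_of_set)
    then show ?thesis
      using density_enn2real_RN_deriv[of "N S" M] prob M by (simp add: x_def)
  qed
  \<comment> \<open>The uniform distribution on \<open>I\<close> is the coupling: \<open>a\<close>
    is the element that \<open>c\<close> displaces. Each sample without \<open>c\<close> occurs
    \<open>m\<close> times as first member and each sample with \<open>c\<close> occurs
    \<open>r\<close> times as second, so both marginals are uniform.\<close>
  define I where "I = (SIGMA S:A\<^sub>0. S)"
  define X where "X = (\<lambda>(S, a :: 'c). x S)"
  define Y where "Y = (\<lambda>(S, a). x (insert c (S - {a})))"
  have finI: "finite I" unfolding I_def using fin D finite_subset by (intro finite_SigmaI) (auto simp: A\<^sub>0_def)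
  have sumX: "(\<Sum>(S, a)\<in>I. f S) = real m * (\<Sum>S\<in>A\<^sub>0. f S)" for f :: "'c set \<Rightarrow> real"
  proof -
    have "(\<Sum>(S, a)\<in>I. f S) = (\<Sum>S\<in>A\<^sub>0. \<Sum>a\<in>S. f S)"
      unfolding I_def using fin D finite_subset by (subst sum.Sigma) (auto simp: A\<^sub>0_def)
    also have "\<dots> = (\<Sum>S\<in>A\<^sub>0. real m * f S)" by (intro sum.cong) (auto simp: A\<^sub>0_def)
    finally show ?thesis by (simp add: sum_distrib_left)
  qed
  have sum1: "(\<Sum>S\<in>A\<^sub>1. f S) = (\<Sum>R\<in>R\<^sub>1. f (insert c R))" for f :: "'c set \<Rightarrow> real"
    unfolding A\<^sub>1_def using sum.reindex[OF inj] by simp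
  have sumY: "(\<Sum>(S, a)\<in>I. f (insert c (S - {a}))) = real r * (\<Sum>S\<in>A\<^sub>1. f S)" for f :: "'c set \<Rightarrow> real"
    using sum_subsets_remove[OF D(1,3), of "\<lambda>R. f (insert c R)"]
    by (simp add: I_def A\<^sub>0_def R\<^sub>1_def r_def sum1)
  have cardI: "real (card I) = real m * real (card A\<^sub>0)" "real (card I) = real r * real (card A\<^sub>1)"
    using sumX[of "\<lambda>_. 1"] sumY[of "\<lambda>_. 1"] by (simp_all add: case_prod_beta)
  have card0: "0 < real (card A\<^sub>0)" using ne0 fin by (simp add: card_gt_0_iff)
  have neI: "I \<noteq> {}" using cardI(1) card0 D by auto
  then have cardI0: "0 < real (card I)" using finI by (simp add: card_gt_0_iff)
  then have card1: "0 < real (card A\<^sub>1)" using cardI(2) by (simp add: zero_less_mult_iff)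
  define p where "p z = (\<Sum>i\<in>I. X i z) / real (card I)" for z
  define p\<^sub>c where "p\<^sub>c z = (\<Sum>i\<in>I. Y i z) / real (card I)" for z
  define \<gamma> where "\<gamma> = real m / real (Suc (card D))"
  have \<gamma>: "0 \<le> \<gamma>" "\<gamma> \<le> 1" "\<gamma> \<le> q" using D q by (auto simp: \<gamma>_def)
  define p' where "p' z = (1 - \<gamma>) * p z + \<gamma> * p\<^sub>c z" for z
  have p_eq: "p z = (\<Sum>S\<in>A\<^sub>0. x S z) / real (card A\<^sub>0)" for z
    using sumX[of "\<lambda>S. x S z"] D card0 by (simp add: p_def X_def cardI(1) case_prod_beta)
  have pc_eq: "p\<^sub>c z = (\<Sum>S\<in>A\<^sub>1. x S z) / real (card A\<^sub>1)" for z
    using sumY[of "\<lambda>S. x S z"] r card1 by (simp add: p\<^sub>c_def Y_def cardI(2) case_prod_beta)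
  have p'_eq: "p' z = (\<Sum>S\<in>F. x S z) / real (card F)" for z
  proof -
    have cF: "real (card F) = real (card A\<^sub>0) + real (card A\<^sub>1)"
      unfolding F(1) using fin F(2) by (subst card_Un_disjoint) auto
    \<comment> \<open>Counting \<open>I\<close> in two ways identifies \<gamma> as the proportion of
      samples that contain \<open>c\<close>, without evaluating binomial coefficients.\<close>
    have "real m + real r = real (Suc (card D))" using D by (simp add: r_def of_nat_diff)
    moreover have "real m * real (card A\<^sub>0) = real r * real (card A\<^sub>1)" using cardI by simp
    ultimately have "real (Suc (card D)) * real (card A\<^sub>1) = real m * real (card F)"
      unfolding cF by (metis distrib_right distrib_left add.commute)
    then have g1: "\<gamma> = real (card A\<^sub>1) / real (card F)"
      using cF card0 by (simp add: \<gamma>_def field_simps)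
    then have g0: "1 - \<gamma> = real (card A\<^sub>0) / real (card F)"
      using cF card0 by (simp add: field_simps)
    have "p' z = ((\<Sum>S\<in>A\<^sub>0. x S z) + (\<Sum>S\<in>A\<^sub>1. x S z)) / real (card F)"
      unfolding p'_def p_eq pc_eq unfolding g0 unfolding g1 using card0 card1 by (simp add: add_divide_distrib)
    then show ?thesis unfolding F(1) using fin F(2) by (simp add: sum.union_disjoint)
  qed
  have P_dens: "P = density M (\<lambda>z. ennreal (p z))"
    unfolding P p_eq using fin ne0 dens F N M(2) x_meas x0
    by (intro bind_pmf_of_set_eq_density) auto
  have P'_dens: "P' = density M (\<lambda>z. ennreal (p' z))"
    unfolding P' p'_eq using fin neF dens N M(2) x_meas x0
    by (intro bind_pmf_of_set_eq_density) auto
  have XY_meas [measurable]: "X i \<in> borel_measurable M" "Y i \<in> borel_measurable M" for i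
    by (cases i; simp add: X_def Y_def)+
  have XY0: "0 \<le> X i z" "0 \<le> Y i z" for i z
    by (cases i; simp add: X_def Y_def x0)+
  have p_meas [measurable]: "p \<in> borel_measurable M" "p\<^sub>c \<in> borel_measurable M" "p' \<in> borel_measurable M"
    unfolding p_def[abs_def] p\<^sub>c_def[abs_def] p'_def[abs_def] by measurable
  have p0: "0 \<le> p z" "0 \<le> p\<^sub>c z" "0 \<le> p' z" for z
    using XY0 \<gamma> by (auto simp: p_def p\<^sub>c_def p'_def intro!: sum_nonneg divide_nonneg_nonneg add_nonneg_nonneg mult_nonneg_nonneg)
  have adj: "sample_adjacent m S (insert c (S - {a}))" "sample_adjacent m (insert c (S - {a})) S"
    "S \<in> F" "insert c (S - {a}) \<in> F" if "(S, a) \<in> I" for S a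
  proof -
    have S: "S \<subseteq> D" "card S = m" "a \<in> S" "finite S" using that D finite_subset by (auto simp: I_def A\<^sub>0_def)
    have cS: "c \<notin> S" "c \<noteq> a" using S D by auto
    have "card (insert c (S - {a})) = m" using S cS D(3) by (simp add: card_insert_if)
    moreover have "\<exists>R d d'. finite R \<and> d \<notin> R \<and> d' \<notin> R \<and> d \<noteq> d' \<and> S = insert d R \<and> insert c (S - {a}) = insert d' R"
      using S cS by (intro exI[of _ "S - {a}"] exI[of _ a] exI[of _ c]) auto
    moreover have "\<exists>R d d'. finite R \<and> d \<notin> R \<and> d' \<notin> R \<and> d \<noteq> d' \<and> insert c (S - {a}) = insert d R \<and> S = insert d' R"
      using S cS by (intro exI[of _ "S - {a}"] exI[of _ c] exI[of _ a]) auto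
    ultimately show "sample_adjacent m S (insert c (S - {a}))" "sample_adjacent m (insert c (S - {a})) S"
      using S by (auto simp: sample_adjacent_def)
    show "S \<in> F" "insert c (S - {a}) \<in> F" using S \<open>card (insert c (S - {a})) = m\<close> by (auto simp: F_def)
  qed
  have pair: "density_pair M (N S) (N S') (x S) (x S')" if "S \<in> F" "S' \<in> F" for S S'
    by (intro density_pair.intro x_meas x0 dens prob that)
  have bnd: "(\<integral>\<^sup>+z. ennreal (\<bar>X i z - Y i z\<bar> ^ j / X i z ^ (j - 1)) \<partial>M) \<le> ennreal (b j)"
      "(\<integral>\<^sup>+z. ennreal (\<bar>X i z - Y i z\<bar> ^ j / Y i z ^ (j - 1)) \<partial>M) \<le> ennreal (b j)"
      "AE z in M. X i z = 0 \<longleftrightarrow> Y i z = 0" if i: "i \<in> I" and j: "2 \<le> j" "j \<le> Suc n" for i j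
  proof -
    obtain S a where ia: "i = (S, a)" by (cases i)
    note adj = adj[OF i[unfolded ia]]
    let ?S' = "insert c (S - {a})"
    note tb = moment_term_bound[OF pair[OF adj(3,4)] rdp[OF adj(1)] rdp[OF adj(2)] j(1)]
    note tb' = moment_term_bound[OF pair[OF adj(4,3)] rdp[OF adj(2)] rdp[OF adj(1)] j(1)]
    have le: "enn2ereal u \<le> moment_term e j \<Longrightarrow> u \<le> ennreal (b j)" for u
      using b[OF j] b0[of j] by (simp add: less_eq_ennreal.rep_eq)
    show "(\<integral>\<^sup>+z. ennreal (\<bar>X i z - Y i z\<bar> ^ j / X i z ^ (j - 1)) \<partial>M) \<le> ennreal (b j)"
      using le[OF tb'(1)] by (simp add: X_def Y_def ia abs_minus_commute)
    show "(\<integral>\<^sup>+z. ennreal (\<bar>X i z - Y i z\<bar> ^ j / Y i z ^ (j - 1)) \<partial>M) \<le> ennreal (b j)"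
      using le[OF tb(1)] by (simp add: X_def Y_def ia)
    have fin_e: "moment_term e j \<noteq> \<infinity>" using b[OF j] by simp
    have "AE z in M. x ?S' z = 0 \<longrightarrow> x S z = 0"
      by (rule moment_term_bound(2)[OF pair[OF adj(3,4)] rdp[OF adj(1)] rdp[OF adj(2)] j(1) fin_e])
    moreover have "AE z in M. x S z = 0 \<longrightarrow> x ?S' z = 0"
      by (rule moment_term_bound(2)[OF pair[OF adj(4,3)] rdp[OF adj(2)] rdp[OF adj(1)] j(1) fin_e])
    ultimately show "AE z in M. X i z = 0 \<longleftrightarrow> Y i z = 0"
      by eventually_elim (auto simp: X_def Y_def ia)
  qed
  have null: "AE z in M. \<forall>i\<in>I. X i z = 0 \<longleftrightarrow> Y i z = 0"
    using finI bnd(3)[of _ 2] n by (intro AE_finite_allI) auto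
  have null_p: "AE z in M. p z = 0 \<longleftrightarrow> p\<^sub>c z = 0"
    using null
  proof eventually_elim
    case (elim z)
    have "p z = 0 \<longleftrightarrow> (\<forall>i\<in>I. X i z = 0)" "p\<^sub>c z = 0 \<longleftrightarrow> (\<forall>i\<in>I. Y i z = 0)"
      using XY0 finI cardI0 by (auto simp: p_def p\<^sub>c_def sum_nonneg_eq_0_iff)
    with elim show ?case by auto
  qed
  have dev: "(\<integral>\<^sup>+z. ennreal (\<bar>p z - p\<^sub>c z\<bar> ^ j / ((1 - g) * p z + g * p\<^sub>c z) ^ (j - 1)) \<partial>M) \<le> ennreal (b j)"
    if j: "2 \<le> j" "j \<le> Suc n" and g: "0 \<le> g" "g \<le> 1" for j g
  proof -
    obtain k where k: "j = Suc k" using j by (cases j) auto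
    show ?thesis unfolding k diff_Suc_1
      using bnd[OF _ j] b0[of j] finI neI g XY0 unfolding k diff_Suc_1
      by (intro nn_integral_mixture_deviation_le[where I = I and X = X and Y = Y]) (auto simp: p_def p\<^sub>c_def)
  qed
  have probs: "prob_space P" "prob_space P'" using Pprob by (auto simp: P P' space_prob_algebra)
  have nn: "(\<integral>\<^sup>+z. ennreal (p z) \<partial>M) = 1" "(\<integral>\<^sup>+z. ennreal (p' z) \<partial>M) = 1"
    using prob_space.emeasure_space_1[OF probs(1)] prob_space.emeasure_space_1[OF probs(2)]
    unfolding P_dens P'_dens by (simp_all add: emeasure_density cong: nn_integral_cong)
  have C: "1 + (\<Sum>j=2..Suc n. real (Suc n choose j) * \<gamma> ^ j * b j) \<le> C"
    unfolding C_def using b0 \<gamma>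
    by (intro add_left_mono sum_mono mult_right_mono mult_left_mono power_mono) auto
  have null': "AE z in M. p' z = 0 \<longrightarrow> p z = 0" "AE z in M. p z = 0 \<longrightarrow> p' z = 0"
  proof -
    show "AE z in M. p z = 0 \<longrightarrow> p' z = 0" using null_p by eventually_elim (auto simp: p'_def)
    show "AE z in M. p' z = 0 \<longrightarrow> p z = 0"
      using null_p
    proof eventually_elim
      case (elim z)
      show ?case
      proof
        assume "p' z = 0"
        then have "(1 - \<gamma>) * p z = 0" "\<gamma> * p\<^sub>c z = 0"
          using \<gamma> p0[of z] by (auto simp: p'_def add_nonneg_eq_0_iff)
        with elim show "p z = 0" by (cases "\<gamma> = 0") auto
      qed
    qed
  qed
  \<comment> \<open>Reference law of the smaller population, that is \<open>g = 0\<close>, with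
    deviation \<open>p\<^sub>c z - p z\<close>.\<close>
  have up: "integrable M (\<lambda>z. p' z ^ Suc n / p z ^ n)"
    "(\<integral>z. p' z ^ Suc n / p z ^ n \<partial>M) \<le> 1 + (\<Sum>j=2..Suc n. real (Suc n choose j) * \<gamma> ^ j * b j)"
    using binomial_moment_le[of p' M p "\<lambda>z. p\<^sub>c z - p z" \<gamma> b n] dev[of _ 0] p0 nn \<gamma>(1) null'(2) b0
    by (auto simp: p'_def algebra_simps abs_minus_commute simp del: power_Suc binomial_Suc_Suc sum.cl_ivl_Suc)
  \<comment> \<open>Reference law of the larger population, that is \<open>g = \<gamma>\<close>,
    with the deviation of opposite sign:
    \<open>p z = p' z + \<gamma> * (p z - p\<^sub>c z)\<close>.\<close>
  have down: "integrable M (\<lambda>z. p z ^ Suc n / p' z ^ n)"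
    "(\<integral>z. p z ^ Suc n / p' z ^ n \<partial>M) \<le> 1 + (\<Sum>j=2..Suc n. real (Suc n choose j) * \<gamma> ^ j * b j)"
    using binomial_moment_le[of p M p' "\<lambda>z. p z - p\<^sub>c z" \<gamma> b n] dev[of _ \<gamma>] p0 nn \<gamma>(1,2) null'(1) b0
    by (auto simp: p'_def algebra_simps simp del: power_Suc binomial_Suc_Suc sum.cl_ivl_Suc)
  show "moment_bound n C P P'"
    by (rule moment_bound_density[OF n p_meas(1) p0(1) p_meas(3) p0(3) P_dens probs(1) P'_dens probs(2)
      null'(1) down(1) order_trans[OF down(2) C]])
  show "moment_bound n C P' P"
    by (rule moment_bound_density[OF n p_meas(3) p0(3) p_meas(1) p0(1) P'_dens probs(2) P_dens probs(1)
      null'(2) up(1) order_trans[OF up(2) C]])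
qed

section \<open>Composition of the rounds\<close>

text \<open>\<open>C\<close> is the same for all starting models, so
  \<open>moment_bound_bind\<close> contributes one factor \<open>C\<close> per round although the
  rounds are adaptive.\<close>

lemma rr_cluster_run_moment_bound:
  fixes A :: "('c, 'd::finite, 'k::finite, 's, 'p) rr_cluster"
  assumes wf: "wf_rr_cluster A" and n: "0 < n" and C: "0 \<le> C"
    and D: "finite D" "m \<le> card D" and D': "finite D'" "m \<le> card D'"
    and reg: "\<And>\<theta>. sets (single_round A \<theta> (SOME S. True)) = sets borel"
    and round: "\<And>\<theta>. moment_bound n C (sampled_round A (sample_clients m D) \<theta>) (sampled_round A (sample_clients m D') \<theta>)"
  shows "moment_bound n (C ^ t) (rr_cluster_run A m \<theta>\<^sub>0 t D) (rr_cluster_run A m \<theta>\<^sub>0 t D')"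
proof (induction t)
  case 0
  have "return borel \<theta>\<^sub>0 \<in> space (prob_algebra borel)" by (simp add: space_prob_algebra prob_space_return)
  from moment_bound_self[OF n this] show ?case by simp
next
  case (Suc t)
  note run = rr_cluster_run_in_prob_algebra[OF wf _ _ reg]
  note kernel = measurable_sampled_round[OF wf finite_set_pmf_sample_clients(1)]
  have "moment_bound n (C ^ t * C)
      (Giry_Monad.bind (rr_cluster_run A m \<theta>\<^sub>0 t D) (sampled_round A (sample_clients m D)))
      (Giry_Monad.bind (rr_cluster_run A m \<theta>\<^sub>0 t D') (sampled_round A (sample_clients m D')))"
    using C by (intro moment_bound_bind[OF n _ _ run[OF D] run[OF D'] kernel[OF D] kernel[OF D'] Suc round]) auto
  then show ?case
    unfolding rr_cluster_run_regular[OF wf D reg] rr_cluster_run_regular[OF wf D' reg] by (simp add: mult.commute)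
qed

lemma sampled_round_moment_bound:
  fixes A :: "('c, 'd::finite, 'k::finite, 's, 'p) rr_cluster" and e :: "ereal \<Rightarrow> ereal" and q :: real
  assumes wf: "wf_rr_cluster A"
    and rdp: "\<And>a. 1 < a \<Longrightarrow> rdp (sample_adjacent m) (single_round A \<theta>) a (e a)"
    and adj: "population_adjacent m M D D'"
    and m: "1 \<le> m" "real m \<le> q * real M" and q: "0 < q"
    and b: "\<And>j. 2 \<le> j \<Longrightarrow> j \<le> Suc n \<Longrightarrow> moment_term e j = ereal (b j)" and b0: "\<And>j. 0 \<le> b j" and n: "0 < n"
  shows "moment_bound n (1 + (\<Sum>j=2..Suc n. real (Suc n choose j) * q ^ j * b j))
    (sampled_round A (sample_clients m D) \<theta>) (sampled_round A (sample_clients m D') \<theta>)"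
proof -
  let ?N = "\<lambda>S. if finite S then single_round A \<theta> S else return borel \<theta>"
  have N: "?N S \<in> space (prob_algebra borel)" for S
    using measurable_space[OF single_round_or_return_in_prob_algebra[OF wf], of \<theta> S] by simp
  have "renyi_divergence a (?N S) (?N S') \<le> e a" if "sample_adjacent m S S'" "1 < a" for S S' a
  proof -
    have "finite S" "finite S'" using that by (auto simp: sample_adjacent_def)
    then show ?thesis using rdp[OF that(2)] that(1) by (simp add: rdp_def)
  qed
  note step = moment_bound_subsampling[where N = ?N and e = e and b = b and n = n and q = q and m = m, OF _ _ m(1) _ N this b b0 _ n]
  \<comment> \<open>Here \<open>D\<close> is the smaller population, and \<open>M\<close> may be the
    size of either one; the larger population has at least \<open>M\<close> clients in both
    cases.\<close>
  have frac: "real m / real (Suc (card D)) \<le> q" if "card D = M \<or> Suc (card D) = M" for D :: "'c set"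
  proof -
    have "real m \<le> q * real (Suc (card D))"
      using that m(2) q by (auto simp: distrib_left)
    then show ?thesis by (simp add: divide_le_eq)
  qed
  from adj have fin: "finite D" "finite D'" "m \<le> card D" "m \<le> card D'" and M: "card D = M \<or> card D' = M"
    and ar: "add_remove D D'" by (auto simp: population_adjacent_def)
  from ar show ?thesis
    unfolding add_remove_def
  proof (elim disjE exE conjE)
    fix c assume c: "c \<notin> D" "D' = insert c D"
    show ?thesis unfolding sampled_round_def c(2)
      using fin M c by (intro step(1) frac) auto
  next
    fix c assume c: "c \<notin> D'" "D = insert c D'"
    show ?thesis unfolding sampled_round_def c(2)
      using fin M c by (intro step(2) frac) auto
  qed
qed

text \<open>Supplies the pair needed for \<open>moment_term_nonneg\<close>. A sample from the
  smaller population and the additional client give it; \<open>m\<close> must be positive so that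
  there is an element to displace.\<close>

lemma sample_adjacent_exists:
  fixes D D' :: "'c set"
  assumes adj: "population_adjacent m M D D'" and m: "1 \<le> m"
  shows "\<exists>S S' :: 'c set. sample_adjacent m S S' \<and> sample_adjacent m S' S"
proof -
  obtain E :: "'c set" and c where E: "c \<notin> E" "finite E" "m \<le> card E"
    using adj by (auto simp: population_adjacent_def add_remove_def)
  obtain S where S: "S \<subseteq> E" "card S = m" "finite S" using obtain_subset_with_card_n[OF E(3)] by blast
  then obtain s where s: "s \<in> S" using m by fastforce
  have c: "c \<notin> S" "c \<noteq> s" using S s E by auto
  have card: "card (insert c (S - {s})) = m" using S s c m by (simp add: card_insert_if)
  have "\<exists>R d d'. finite R \<and> d \<notin> R \<and> d' \<notin> R \<and> d \<noteq> d' \<and> S = insert d R \<and> insert c (S - {s}) = insert d' R"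
    using S s c by (intro exI[of _ "S - {s}"] exI[of _ s] exI[of _ c]) auto
  moreover have "\<exists>R d d'. finite R \<and> d \<notin> R \<and> d' \<notin> R \<and> d \<noteq> d' \<and> insert c (S - {s}) = insert d R \<and> S = insert d' R"
    using S s c by (intro exI[of _ "S - {s}"] exI[of _ c] exI[of _ s]) auto
  ultimately show ?thesis
    using S card unfolding sample_adjacent_def by blast
qed

lemma amplification_factor_eq:
  fixes e :: "ereal \<Rightarrow> ereal" and q :: real
  assumes "2 \<le> \<alpha>"
  shows "1 + ereal (q ^ 2 * real (\<alpha> choose 2)) *
             min (4 * (ereal_exp (e 2) - 1)) (ereal_exp (e 2) * min 2 ((ereal_exp (e \<infinity>) - 1) ^ 2))
         + (\<Sum>j = 3..\<alpha>. ereal (q ^ j * real (\<alpha> choose j)) *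
             ereal_exp (ereal (real j - 1) * e (ereal (real j))) * min 2 ((ereal_exp (e \<infinity>) - 1) ^ j))
    = 1 + (\<Sum>j = 2..\<alpha>. ereal (q ^ j * real (\<alpha> choose j)) * moment_term e j)"
proof -
  have "{2..\<alpha>} = insert 2 {3..\<alpha>}" using assms by auto
  moreover have "moment_term e 2 =
      min (4 * (ereal_exp (e 2) - 1)) (ereal_exp (e 2) * min 2 ((ereal_exp (e \<infinity>) - 1) ^ 2))"
    by (simp add: moment_term_def Let_def one_ereal_def[symmetric])
  moreover have "moment_term e j = ereal_exp (ereal (real j - 1) * e (ereal (real j))) * min 2 ((ereal_exp (e \<infinity>) - 1) ^ j)"
    if "j \<in> {3..\<alpha>}" for j using that by (simp add: moment_term_def)
  ultimately show ?thesis by (simp add: mult.assoc add.assoc)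
qed

theorem theorem4p2:
  fixes A :: "('c, 'd::finite, 'k::finite, 's, 'p) rr_cluster"
    and \<theta>\<^sub>0 :: "('d, 'k) models"
    and q :: real and M T :: nat
    and \<epsilon>\<^sub>1 \<epsilon>\<^sub>2 :: "ereal \<Rightarrow> ereal"
  assumes "wf_rr_cluster A"
    and "0 < q" and "q \<le> 1"
    and "real (threshold A) \<le> q * real M / real CARD('k)"
    and "\<And>\<theta> a. 1 < a \<Longrightarrow>
      rdp (sample_adjacent (sample_size q M)) (single_round A \<theta>) a (\<epsilon>\<^sub>1 a + \<epsilon>\<^sub>2 a)"
  shows "\<exists>\<epsilon> :: nat \<Rightarrow> ereal. \<forall>\<alpha>\<ge>2.
    rdp (population_adjacent (sample_size q M) M)
      (rr_cluster_run A (sample_size q M) \<theta>\<^sub>0 T) (ereal (real \<alpha>)) (\<epsilon> \<alpha>) \<and>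
    \<epsilon> \<alpha> \<le> ereal (real T / (real \<alpha> - 1)) * ereal_ln
      (1 + ereal (q ^ 2 * real (\<alpha> choose 2)) *
             min (4 * (ereal_exp (\<epsilon>\<^sub>1 2 + \<epsilon>\<^sub>2 2) - 1))
                 (ereal_exp (\<epsilon>\<^sub>1 2 + \<epsilon>\<^sub>2 2) *
                    min 2 ((ereal_exp (\<epsilon>\<^sub>1 \<infinity> + \<epsilon>\<^sub>2 \<infinity>) - 1) ^ 2))
         + (\<Sum>j = 3..\<alpha>. ereal (q ^ j * real (\<alpha> choose j)) *
             ereal_exp (ereal (real j - 1) * (\<epsilon>\<^sub>1 (ereal (real j)) + \<epsilon>\<^sub>2 (ereal (real j)))) *
             min 2 ((ereal_exp (\<epsilon>\<^sub>1 \<infinity> + \<epsilon>\<^sub>2 \<infinity>) - 1) ^ j)))"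
proof -
  define m where "m = sample_size q M"
  define e where "e a = \<epsilon>\<^sub>1 a + \<epsilon>\<^sub>2 a" for a
  define bound where "bound \<alpha> = ereal (real T / (real \<alpha> - 1)) *
    ereal_ln (1 + (\<Sum>j = 2..\<alpha>. ereal (q ^ j * real (\<alpha> choose j)) * moment_term e j))" for \<alpha>
  \<comment> \<open>Threshold and number of clusters are at least 1, so rounding down
    \<open>q * real M\<close> leaves a nonempty sample.\<close>
  have "1 * 1 \<le> real (threshold A) * real CARD('k)"
    using assms(1) by (intro mult_mono) (auto simp: wf_rr_cluster_def Suc_le_eq)
  also have "\<dots> \<le> q * real M" using assms(4) by (simp add: le_divide_eq)
  finally have "1 \<le> \<lfloor>q * real M\<rfloor>" by simp
  then have m1: "1 \<le> m" and "real m = of_int \<lfloor>q * real M\<rfloor>" unfolding m_def sample_size_def by linarith+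
  then have mq: "real m \<le> q * real M" by simp
  have round: "rdp (sample_adjacent m) (single_round A \<theta>) a (e a)" if "1 < a" for \<theta> a
    using assms(5)[OF that] by (simp add: m_def e_def)
  have "rdp (population_adjacent m M) (rr_cluster_run A m \<theta>\<^sub>0 T) (ereal (real \<alpha>)) (bound \<alpha>)" if \<alpha>: "2 \<le> \<alpha>" for \<alpha>
    unfolding rdp_def
  proof (intro allI impI)
    fix D D' :: "'c set" assume adj: "population_adjacent m M D D'"
    then have fin: "finite D" "m \<le> card D" "finite D'" "m \<le> card D'" by (auto simp: population_adjacent_def)
    obtain n where n: "\<alpha> = Suc n" "0 < n" using \<alpha> by (cases \<alpha>) auto
    let ?P = "rr_cluster_run A m \<theta>\<^sub>0 T D" and ?Q = "rr_cluster_run A m \<theta>\<^sub>0 T D'"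
    obtain S S' :: "'c set" where SS': "sample_adjacent m S S'" "sample_adjacent m S' S"
      using sample_adjacent_exists[OF adj m1] by blast
    then have "finite S" "finite S'" by (auto simp: sample_adjacent_def)
    then have "single_round A \<theta>\<^sub>0 S \<in> space (prob_algebra borel)" "single_round A \<theta>\<^sub>0 S' \<in> space (prob_algebra borel)"
      using measurable_space[OF measurable_single_round[OF assms(1)]] by auto
    then have term0: "0 \<le> moment_term e j" if "2 \<le> j" for j
      using round[of _ \<theta>\<^sub>0] SS' that
      by (intro moment_term_nonneg[of "single_round A \<theta>\<^sub>0 S" "single_round A \<theta>\<^sub>0 S'"]) (auto simp: rdp_def space_prob_algebra)
    have "renyi_finite (real (Suc n)) ?P ?Q \<le> bound \<alpha>"
    proof (cases "T = 0")
      \<comment> \<open>Without rounds the bound is 0 even if the logarithm is infinite, since 0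
        times \<infinity> is 0. Infinite coefficients therefore make the bound vacuous only for
        positive \<open>T\<close>, and this case is treated apart.\<close>
      case True
      have P: "return borel \<theta>\<^sub>0 \<in> space (prob_algebra borel)" by (simp add: space_prob_algebra prob_space_return)
      have "renyi_finite (real (Suc n)) (return borel \<theta>\<^sub>0) (return borel \<theta>\<^sub>0) \<le> ereal (ln 1 / real n)"
        using P n(2) moment_bound_self[OF n(2) P]
        by (intro renyi_finite_le_of_moment_bound) (auto simp: space_prob_algebra)
      then show ?thesis by (simp add: True bound_def zero_ereal_def[symmetric] del: of_nat_Suc)
    next
      case T: False
      then obtain t where t: "T = Suc t" by (cases T) auto
      show ?thesis
      proof (cases "\<forall>\<theta>. sets (single_round A \<theta> (SOME S. True)) = sets borel")
        case False
        then have "\<And>\<theta>. space (single_round A \<theta> (SOME S. True)) = {}"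
          using single_round_space_dichotomy[OF assms(1)] by blast
        from space_rr_cluster_run_degenerate[OF this] have "renyi_finite (real (Suc n)) ?P ?Q = -\<infinity>"
          unfolding t using n by (intro renyi_finite_empty_space) auto
        then show ?thesis by simp
      next
        case reg: True
        show ?thesis
        proof (cases "\<exists>j\<in>{2..\<alpha>}. moment_term e j = \<infinity>")
          case True
          then obtain j where j: "j \<in> {2..\<alpha>}" "moment_term e j = \<infinity>" by blast
          have "0 < q ^ j * real (\<alpha> choose j)" using j assms(2) by simp
          then have "\<infinity> = ereal (q ^ j * real (\<alpha> choose j)) * moment_term e j" using j assms(2) by simp
          also have "\<dots> \<le> (\<Sum>j = 2..\<alpha>. ereal (q ^ j * real (\<alpha> choose j)) * moment_term e j)"
            using j(1) term0 assms(2)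
              sum_mono2[of "{2..\<alpha>}" "{j}" "\<lambda>j. ereal (q ^ j * real (\<alpha> choose j)) * moment_term e j"] by simp
          finally have "(\<Sum>j = 2..\<alpha>. ereal (q ^ j * real (\<alpha> choose j)) * moment_term e j) = \<infinity>" by simp
          then have "bound \<alpha> = \<infinity>" using T n by (simp add: bound_def ereal_ln_def)
          then show ?thesis by simp
        next
          case False
          \<comment> \<open>The maximum makes \<open>b\<close> nonnegative at every index, also
            outside the range from 2 to \<open>\<alpha>\<close>, where nothing ties it to a finite
            moment term.\<close>
          define b where "b j = max 0 (real_of_ereal (moment_term e j))" for j
          have b: "moment_term e j = ereal (b j)" if "2 \<le> j" "j \<le> Suc n" for j
          proof -
            have "moment_term e j \<noteq> \<infinity>" "0 \<le> moment_term e j" using False that n(1) term0 by auto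
            then show ?thesis by (cases "moment_term e j") (auto simp: b_def)
          qed
          have b0: "0 \<le> b j" for j by (simp add: b_def)
          define C where "C = 1 + (\<Sum>j=2..Suc n. real (Suc n choose j) * q ^ j * b j)"
          have C: "1 \<le> C" using b0 assms(2) by (auto simp: C_def intro!: sum_nonneg simp del: sum.cl_ivl_Suc)
          have "moment_bound n (C ^ T) ?P ?Q"
            using reg sampled_round_moment_bound[OF assms(1) round adj m1 mq assms(2) b b0 n(2)] C
            by (intro rr_cluster_run_moment_bound[OF assms(1) n(2) _ fin]) (auto simp: C_def)
          moreover have "?P \<in> space (prob_algebra borel)" "?Q \<in> space (prob_algebra borel)"
            using reg fin by (intro rr_cluster_run_in_prob_algebra[OF assms(1)]; simp)+
          ultimately have "renyi_finite (real (Suc n)) ?P ?Q \<le> ereal (ln (C ^ T) / real n)"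
            using C n by (intro renyi_finite_le_of_moment_bound) (auto simp: space_prob_algebra)
          also have "(\<Sum>j = 2..\<alpha>. ereal (q ^ j * real (\<alpha> choose j)) * moment_term e j) =
              (\<Sum>j = 2..\<alpha>. ereal (real (Suc n choose j) * q ^ j * b j))"
            using b n(1) by (intro sum.cong) (auto simp: mult_ac)
          then have "ereal (ln (C ^ T) / real n) = bound \<alpha>"
            using C n by (simp add: bound_def C_def one_ereal_def ln_realpow)
          finally show ?thesis .
        qed
      qed
    qed
    then show "renyi_divergence (ereal (real \<alpha>)) ?P ?Q \<le> bound \<alpha>"
      by (simp add: renyi_divergence_def n(1) del: of_nat_Suc)
  qed
  moreover have "bound \<alpha> = ereal (real T / (real \<alpha> - 1)) * ereal_ln
      (1 + ereal (q ^ 2 * real (\<alpha> choose 2)) *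
             min (4 * (ereal_exp (\<epsilon>\<^sub>1 2 + \<epsilon>\<^sub>2 2) - 1))
                 (ereal_exp (\<epsilon>\<^sub>1 2 + \<epsilon>\<^sub>2 2) *
                    min 2 ((ereal_exp (\<epsilon>\<^sub>1 \<infinity> + \<epsilon>\<^sub>2 \<infinity>) - 1) ^ 2))
         + (\<Sum>j = 3..\<alpha>. ereal (q ^ j * real (\<alpha> choose j)) *
             ereal_exp (ereal (real j - 1) * (\<epsilon>\<^sub>1 (ereal (real j)) + \<epsilon>\<^sub>2 (ereal (real j)))) *
             min 2 ((ereal_exp (\<epsilon>\<^sub>1 \<infinity> + \<epsilon>\<^sub>2 \<infinity>) - 1) ^ j)))" if "2 \<le> \<alpha>" for \<alpha>
    using amplification_factor_eq[OF that, of q e] unfolding bound_def by (simp only: e_def)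
  ultimately show ?thesis unfolding m_def by (intro exI[of _ bound]) auto
qed

end
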